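(* Let $\mathcal{Q}$ be an $[\![n,k,d]\!]$ self-dual CSS code with $k \geq 1$ which is constructed from a parity check matrix of a classical binary linear code $\mathcal{D}\subseteq \mathbb{Z}_2^n$ satisfying $\mathcal{D}^\perp \subsetneq \mathcal{D}$. Suppose that $\mathcal{D}^\perp = \langle \mathbf{g}_i \rangle_{i\in[r]}$ and $\mathcal{D} = \langle \mathbf{g}_i,\mathbf{h}_j \rangle_{i\in[r],\,j\in[k]}$, where $\mathbf{g}_i,\mathbf{h}_j \in \mathbb{Z}_2^n$ and $r=(n-k)/2$. The following statements are equivalent: 1. There exists $j \in [k]$ such that $\mathbf{h}_j \cdot \mathbf{h}_j = 1$. 2. There exists at least one hyperbolic pair $(\bar{L}^x,\bar{L}^z)$ of $\mathcal{Q}$, where $\bar{L}^x \in \mathcal{P}_n^x$ and $\bar{L}^z \in \mathcal{P}_n^z$, such that $\mathrm{supp}(\bar{L}^x)=\mathrm{supp}(\bar{L}^z)$. 3. There exists a symplectic basis $\{(\bar{X}_j,\bar{Z}_j)\}_{j\in[k]}$ of $\mathcal{Q}$, where $\{\bar{X}_j\} \subsetneq \mathcal{P}_n^x$ and $\{\bar{Z}_j\} \subsetneq \mathcal{P}_n^z$, such that $\mathrm{supp}(\bar{X}_j)=\mathrm{supp}(\bar{Z}_j)$ for all $j \in [k]$. 4. There exists a symplectic basis of $\mathcal{Q}$ which is compatible with multilevel transversal Clifford operations.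
   Context: $[k]=\{1,\dots,k\}$. For $\mathbf{a},\mathbf{b}\in\mathbb{Z}_2^n$, $\mathbf{a}\cdot\mathbf{b}=\sum_i a_ib_i \pmod 2$, and $\mathcal{D}^\perp$ is the dual code with respect to this product. $\mathcal{P}_n$ is the $n$-qubit Pauli group; $\mathcal{P}_n^x$ (resp. $\mathcal{P}_n^z$) is the group of $X$-type (resp. $Z$-type) Pauli operators, i.e. tensor products of $I$'s and $X$'s (resp. of $I$'s and $Z$'s). $\mathrm{supp}(U)$ is the set of physical qubits on which $U$ acts non-trivially. Self-dual CSS code: let $H\in\mathbb{Z}_2^{r\times n}$ be a full-row-rank parity check matrix, with rows $\mathbf{g}_1,\dots,\mathbf{g}_r$, of a binary linear code $\mathcal{D}$ with $\mathcal{D}^\perp\subseteq\mathcal{D}$. The code $\mathcal{Q}$ is the stabilizer code whose stabilizer group $S$ is generated by the operators $g_i^x\in\mathcal{P}_n^x$ and $g_i^z\in\mathcal{P}_n^z$ both having support $\{q:(\mathbf{g}_i)_q=1\}$, $i\in[r]$. It encodes $k=n-2r$ logical qubits; $d$ is its distance. Symplectic basis: let $C(S)$ be the group of all Pauli operators commuting with every element of $S$. A symplectic basis of $\mathcal{Q}$ is a set of $k$ pairs $\{(\bar X_j,\bar Z_j)\}_{j\in[k]}$ of Pauli operators in $C(S)$ which together with $S$ and $iI^{\otimes n}$ generate $C(S)$ and satisfy: $\bar X_j$ and $\bar Z_j$ anticommute for every $j$, and $\bar X_j,\bar Z_{j'}$ commute for $j\ne j'$, and all $\bar X_j$'s commute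 with one another, and all $\bar Z_j$'s commute with one another. In general $\bar X_j$ (resp. $\bar Z_j$) need not be $X$-type (resp. $Z$-type). A hyperbolic pair of $\mathcal{Q}$ is a pair of logical Pauli operators $(\bar X_j,\bar Z_j)$ of this kind, i.e. an anticommuting pair of elements of $C(S)$. A symplectic basis defines the logical Pauli operators of the $k$ logical qubits and hence the logical gates. A unitary $U$ on the $n$ physical qubits is a logical operator if $USU^\dagger=S$; its logical operation is determined by its action by conjugation on the logical Pauli operators (modulo $S$). An equality between a logical gate and a physical gate means the physical gate preserves $S$ under conjugation and implements that logical gate on the code space (up to global phase). $H_i$ and $S_i$ denote the Hadamard gate and phase gate ($S=\mathrm{diag}(1,i)$) on physical qubit $i$; $\bar H_j,\bar S_j$ denote the corresponding logical gates on logical qubit $j$ ($\bar H_j$ exchanges $\bar X_j$ and $\bar Z_j$; $\bar S_j$ maps $\bar X_j\mapsto i\bar X_j\bar Z_j$, $\bar Z_j\mapsto\bar Z_j$). A symplectic basis of $\mathcal{Q}$ is compatible with multilevel transversal Clifford operations if, for the logical qubits it defines, (i) $\bigotimes_{j=1}^k\bar H_j=\bigotimes_{i=1}^n H_i$; and (ii) for any $(a_1,\dots,a_k)\in\{-1,1\}^k$ there exists $(b_1,\dots,b_n)\in\{-1,1\}^n$ such that $\bigotimes_{j=1}^k\bar S_j^{a_j}=\bigotimes_{i=1}^nS_i^{b_i}$. *)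

theory Defs
  imports "HOL-Analysis.Analysis" "HOL-Library.Z2" "HOL-Algebra.Generated_Groups"
begin

instance bit :: finite
proof
  have "(UNIV :: bit set) = {0, 1}"
    by (auto intro: bit.exhaust)
  then show "finite (UNIV :: bit set)"
    by (metis finite.emptyI finite.insertI)
qed

definition bdot :: "bit ^ 'n \<Rightarrow> bit ^ 'n \<Rightarrow> bit" where
  "bdot a b = (\<Sum>i\<in>UNIV. a $ i * b $ i)"

definition dual_code :: "(bit ^ 'n) set \<Rightarrow> (bit ^ 'n) set" where
  "dual_code D = {x. \<forall>y\<in>D. bdot x y = 0}"

definition parity_check :: "nat \<Rightarrow> (nat \<Rightarrow> bit ^ 'n) \<Rightarrow> (bit ^ 'n) set \<Rightarrow> bool" where
  "parity_check r g D \<longleftrightarrow>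
     inj_on g {1..r} \<and> vec.independent (g ` {1..r}) \<and>
     D = {x. \<forall>i\<in>{1..r}. bdot (g i) x = 0}"

text \<open>
  Qubits are indexed by the finite type \<open>'n\<close>; the computational basis of the
  state space is indexed by \<open>bit ^ 'n\<close>, and operators are complex matrices in
  this basis.  The matrix \<open>mat c\<close> is \<open>c\<close> times the identity, so
  \<open>mat c ** A\<close> is the scalar multiple \<open>cA\<close>.
\<close>

type_synonym gate1 = "complex ^ bit ^ bit"
type_synonym 'n operator = "complex ^ (bit ^ 'n) ^ (bit ^ 'n)"

definition dagger :: "complex ^ 'a ^ 'b \<Rightarrow> complex ^ 'b ^ 'a" where
  "dagger A = (\<chi> x y. cnj (A $ y $ x))"

definition unitary :: "complex ^ 'a ^ 'a \<Rightarrow> bool" where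
  "unitary U \<longleftrightarrow> U ** dagger U = mat 1 \<and> dagger U ** U = mat 1"

definition conjugate :: "complex ^ 'a ^ 'a \<Rightarrow> complex ^ 'a ^ 'a \<Rightarrow> complex ^ 'a ^ 'a" where
  "conjugate U A = U ** A ** dagger U"

definition tensor :: "('n::finite \<Rightarrow> gate1) \<Rightarrow> 'n operator" where
  "tensor U = (\<chi> x y. \<Prod>q\<in>UNIV. U q $ (x $ q) $ (y $ q))"

definition sigma_x :: gate1 where
  "sigma_x = (\<chi> x y. if x = y then 0 else 1)"

definition sigma_z :: gate1 where
  "sigma_z = (\<chi> x y. if x = y then (if x = 0 then 1 else - 1) else 0)"

definition sigma_y :: gate1 where
  "sigma_y = mat \<i> ** sigma_x ** sigma_z"

definition hadamard :: gate1 where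
  "hadamard = (\<chi> x y. (if x = 1 \<and> y = 1 then - 1 else 1) / complex_of_real (sqrt 2))"

text \<open>\<open>phase_gate a\<close> is the \<open>a\<close>-th power of \<open>diag(1, i)\<close>.\<close>

definition phase_gate :: "int \<Rightarrow> gate1" where
  "phase_gate a = (\<chi> x y. if x = y then (if x = 0 then 1 else \<i> powi a) else 0)"

text \<open>
  \<open>U\<close> acts trivially on \<open>q\<close> if it is the identity on qubit \<open>q\<close> tensored with
  some operator \<open>V\<close> on the remaining qubits.
\<close>

definition acts_trivially_on :: "'n operator \<Rightarrow> 'n::finite \<Rightarrow> bool" where
  "acts_trivially_on U q \<longleftrightarrow>
     (\<exists>V. \<forall>x y. U $ x $ y =
        (if x $ q = y $ q then V (restrict (($) x) (- {q})) (restrict (($) y) (- {q})) else 0))"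

definition supp :: "'n::finite operator \<Rightarrow> 'n set" where
  "supp U = {q. \<not> acts_trivially_on U q}"

definition paulis :: "'n::finite operator set" where
  "paulis = {mat c ** tensor P | c P.
     c \<in> {1, - 1, \<i>, - \<i>} \<and> (\<forall>q. P q \<in> {mat 1, sigma_x, sigma_y, sigma_z})}"

definition pauli_group :: "'n::finite operator monoid" where
  "pauli_group = \<lparr>carrier = paulis, mult = (**), one = mat 1\<rparr>"

definition paulis_x :: "'n::finite operator set" where
  "paulis_x = {tensor P | P. \<forall>q. P q \<in> {mat 1, sigma_x}}"

definition paulis_z :: "'n::finite operator set" where
  "paulis_z = {tensor P | P. \<forall>q. P q \<in> {mat 1, sigma_z}}"

definition commutes :: "'n::finite operator \<Rightarrow> 'n operator \<Rightarrow> bool" where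
  "commutes A B \<longleftrightarrow> A ** B = B ** A"

definition anticommutes :: "'n::finite operator \<Rightarrow> 'n operator \<Rightarrow> bool" where
  "anticommutes A B \<longleftrightarrow> A ** B = - (B ** A)"

definition pauli_x :: "bit ^ 'n::finite \<Rightarrow> 'n operator" where
  "pauli_x v = tensor (\<lambda>q. if v $ q = 1 then sigma_x else mat 1)"

definition pauli_z :: "bit ^ 'n::finite \<Rightarrow> 'n operator" where
  "pauli_z v = tensor (\<lambda>q. if v $ q = 1 then sigma_z else mat 1)"

text \<open>A stabilizer code is represented by its stabilizer group \<open>S\<close>.\<close>

definition css_stabilizer :: "nat \<Rightarrow> (nat \<Rightarrow> bit ^ 'n::finite) \<Rightarrow> 'n operator set" where
  "css_stabilizer r g =
     generate pauli_group ((\<lambda>i. pauli_x (g i)) ` {1..r} \<union> (\<lambda>i. pauli_z (g i)) ` {1..r})"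

definition centralizer :: "'n::finite operator set \<Rightarrow> 'n operator set" where
  "centralizer S = {P \<in> paulis. \<forall>s\<in>S. commutes P s}"

text \<open>
  The least weight of a logical Pauli operator acting non-trivially on the code
  space.  It is only meaningful if at least one logical qubit is encoded.
\<close>

definition code_distance :: "'n::finite operator set \<Rightarrow> nat" where
  "code_distance S =
     Min ((\<lambda>P. card (supp P)) ` (centralizer S - generate pauli_group (S \<union> {mat \<i>})))"

definition hyperbolic_pair ::
    "'n::finite operator set \<Rightarrow> 'n operator \<Rightarrow> 'n operator \<Rightarrow> bool" where
  "hyperbolic_pair S A B \<longleftrightarrow> A \<in> centralizer S \<and> B \<in> centralizer S \<and> anticommutes A B"

definition symplectic_basis ::
    "'n::finite operator set \<Rightarrow> nat \<Rightarrow> (nat \<Rightarrow> 'n operator) \<Rightarrow> (nat \<Rightarrow> 'n operator) \<Rightarrow> bool" where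
  "symplectic_basis S k X Z \<longleftrightarrow>
     X ` {1..k} \<subseteq> centralizer S \<and> Z ` {1..k} \<subseteq> centralizer S \<and>
     generate pauli_group (X ` {1..k} \<union> Z ` {1..k} \<union> S \<union> {mat \<i>}) = centralizer S \<and>
     (\<forall>j\<in>{1..k}. anticommutes (X j) (Z j)) \<and>
     (\<forall>i\<in>{1..k}. \<forall>j\<in>{1..k}. i \<noteq> j \<longrightarrow> commutes (X i) (Z j)) \<and>
     (\<forall>i\<in>{1..k}. \<forall>j\<in>{1..k}. commutes (X i) (X j)) \<and>
     (\<forall>i\<in>{1..k}. \<forall>j\<in>{1..k}. commutes (Z i) (Z j))"

definition logical_operator :: "'n::finite operator set \<Rightarrow> 'n operator \<Rightarrow> bool" where
  "logical_operator S U \<longleftrightarrow> unitary U \<and> conjugate U ` S = S"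

text \<open>
  A single-qubit logical gate is given by its action by conjugation on the
  logical Pauli operators: it maps the pair \<open>(X, Z)\<close> of its logical qubit to the
  pair of images.  The inverse of the phase gate \<open>X \<mapsto> iXZ\<close>, \<open>Z \<mapsto> Z\<close>
  maps \<open>X\<close> to \<open>- iXZ\<close>, because \<open>ZZ = I\<close>.  A symplectic basis may contain
  non-Hermitian operators, with \<open>ZZ = - I\<close>, but then no unitary acts as the phase
  gate, since \<open>XX\<close> and \<open>(iXZ)(iXZ)\<close> have different signs.
\<close>

type_synonym 'n logical_gate = "'n operator \<times> 'n operator \<Rightarrow> 'n operator \<times> 'n operator"

definition logical_hadamard :: "'n::finite logical_gate" where
  "logical_hadamard = (\<lambda>(X, Z). (Z, X))"

definition logical_phase :: "int \<Rightarrow> 'n::finite logical_gate" where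
  "logical_phase a = (\<lambda>(X, Z). (mat (\<i> powi a) ** X ** Z, Z))"

definition eq_mod :: "'n::finite operator set \<Rightarrow> 'n operator \<Rightarrow> 'n operator \<Rightarrow> bool" where
  "eq_mod S A B \<longleftrightarrow> (\<exists>s\<in>S. A = B ** s)"

text \<open>
  The physical operator \<open>U\<close> implements the tensor product of the logical gates
  \<open>G 1, \<dots>, G k\<close>.  The action modulo \<open>S\<close> on the logical Pauli operators determines
  the action on the code space up to a global phase.
\<close>

definition implements_logical ::
    "'n::finite operator set \<Rightarrow> nat \<Rightarrow> (nat \<Rightarrow> 'n operator) \<Rightarrow> (nat \<Rightarrow> 'n operator)
      \<Rightarrow> (nat \<Rightarrow> 'n logical_gate) \<Rightarrow> 'n operator \<Rightarrow> bool" where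
  "implements_logical S k X Z G U \<longleftrightarrow>
     logical_operator S U \<and>
     (\<forall>j\<in>{1..k}. eq_mod S (conjugate U (X j)) (fst (G j (X j, Z j))) \<and>
                 eq_mod S (conjugate U (Z j)) (snd (G j (X j, Z j))))"

definition multilevel_compatible ::
    "'n::finite operator set \<Rightarrow> nat \<Rightarrow> (nat \<Rightarrow> 'n operator) \<Rightarrow> (nat \<Rightarrow> 'n operator) \<Rightarrow> bool" where
  "multilevel_compatible S k X Z \<longleftrightarrow>
     implements_logical S k X Z (\<lambda>j. logical_hadamard) (tensor (\<lambda>i. hadamard)) \<and>
     (\<forall>a. (\<forall>j\<in>{1..k}. a j \<in> {- 1, 1}) \<longrightarrow>
        (\<exists>b. (\<forall>i. b i \<in> {- 1, 1}) \<and>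
           implements_logical S k X Z (\<lambda>j. logical_phase (a j)) (tensor (\<lambda>i. phase_gate (b i)))))"

end

theory Submission
  imports Defs
begin

text \<open>
  Every Pauli operator is \<open>c X(a) Z(b)\<close>, and the centralizer of the stabilizer group consists of
  those with \<open>a, b \<in> D\<close>, where \<open>D\<close> carries a symmetric bilinear form with radical \<open>D\<^sup>\<bottom>\<close>.
  A hyperbolic pair with equal supports is a vector \<open>v \<in> D\<close> with \<open>v \<cdot> v = 1\<close>, and a symplectic
  basis with equal supports is an orthonormal basis of \<open>D / D\<^sup>\<bottom>\<close>. Such a basis exists as soon as the
  form is not alternating, and alternation can be tested on generators because \<open>v \<mapsto> v \<cdot> v\<close> is
  linear. The transversal Hadamard gate swaps \<open>X(v)\<close> and \<open>Z(v)\<close>; conversely, if it swaps a pair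
  \<open>c X(a) Z(b)\<close>, \<open>c' X(a') Z(b')\<close> modulo stabilizers, then \<open>(a', b') = (b, a)\<close> modulo the radical, and
  anticommutation gives \<open>a \<cdot> a + b \<cdot> b = 1\<close>.
\<close>

subsection \<open>Binary vectors\<close>

lemma bit_add_self [simp]: "(a::bit) + a = 0"
  by (cases a) simp_all

text \<open>The default simplification rules for \<open>bit\<close> rewrite ring operations to bit operations.\<close>

declare add_bit_eq_xor [simp del] mult_bit_eq_and [simp del]

lemma UNIV_bit: "(UNIV :: bit set) = {0, 1}"
  by (auto intro: bit.exhaust)

lemma vec_add_self [simp]: "(x::bit ^ 'n) + x = 0"
  by (simp add: vec_eq_iff)

lemma vec_add_self_left [simp]: "(x::bit ^ 'n) + (x + y) = y"
  by (simp flip: add.assoc)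

lemma vec_uminus [simp]: "- (x::bit ^ 'n) = x"
  using add_eq_0_iff[of x x] by simp

lemma vec_diff_eq_add [simp]: "(x::bit ^ 'n) - y = x + y"
  by (simp add: diff_conv_add_uminus del: add_uminus_conv_diff)

lemma vec_add_eq_0_iff: "(x::bit ^ 'n) + y = 0 \<longleftrightarrow> x = y"
  by (auto simp: add_eq_0_iff)

lemma vec_subspaceI:
  assumes "0 \<in> A" and "\<And>x y. x \<in> A \<Longrightarrow> y \<in> A \<Longrightarrow> x + y \<in> A"
  shows "vec.subspace (A :: (bit ^ 'n) set)"
  unfolding vec.subspace_def
proof (intro conjI ballI allI)
  fix c :: bit and x assume "x \<in> A"
  then show "c *s x \<in> A"
    using assms(1) by (cases c) simp_all
qed (use assms in auto)

lemma bdot_commute: "bdot a b = bdot b a"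
  unfolding bdot_def by (rule sum.cong) (simp_all only: mult.commute)

lemma bdot_add_left [simp]: "bdot (a + b) c = bdot a c + bdot b c"
  by (simp only: bdot_def sum.distrib[symmetric] distrib_right vector_add_component)

lemma bdot_add_right [simp]: "bdot a (b + c) = bdot a b + bdot a c"
  by (simp only: bdot_def sum.distrib[symmetric] distrib_left vector_add_component)

lemma bdot_zero [simp]: "bdot 0 a = 0" "bdot a 0 = 0"
  by (simp_all add: bdot_def)

lemma bdot_axis: "bdot a (axis i 1) = a $ i"
proof -
  have "bdot a (axis i 1) = (\<Sum>j\<in>UNIV. if j = i then a $ j else 0)"
    unfolding bdot_def axis_def by (rule sum.cong) auto
  then show ?thesis
    by simp
qed

lemma bdot_sum_right: "bdot a (\<Sum>i\<in>I. f i) = (\<Sum>i\<in>I. bdot a (f i))"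
  by (induction I rule: infinite_finite_induct) simp_all

lemma subspace_dual_code: "vec.subspace (dual_code D)"
  by (rule vec_subspaceI) (auto simp: dual_code_def)

text \<open>Over \<open>\<int>\<^sub>2\<close> the map \<open>x \<mapsto> x \<cdot> x\<close> is linear.\<close>

lemma subspace_isotropic: "vec.subspace {x. bdot x x = 0}"
  by (rule vec_subspaceI) (auto simp: bdot_commute)

text \<open>Values prescribed on an independent set extend to a linear functional, and every
  functional on a coordinate space is a dot product. This yields the sign pattern of the transversal
  phase gate.\<close>

lemma exists_bdot_eq:
  fixes B :: "(bit ^ 'n::finite) set"
  assumes "vec.independent B"
  obtains t where "\<And>b. b \<in> B \<Longrightarrow> bdot t b = \<phi> b"
proof -
  \<comment> \<open>The target is \<open>bit ^ 1\<close> instead of \<open>bit\<close> so that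
    \<open>f\<close> has a matrix; its single row is the wanted \<open>t\<close>.\<close>
  obtain f :: "bit ^ 'n \<Rightarrow> bit ^ 1"
    where f: "Vector_Spaces.linear (*s) (*s) f" and fB: "\<forall>b\<in>B. f b = (\<chi> i. \<phi> b)"
    using vec.linear_independent_extend[OF assms, of "\<lambda>b. \<chi> i. \<phi> b"] by blast
  have "bdot (matrix f $ 1) b = f b $ 1" for b
    using matrix_works[OF f, of b] by (simp add: bdot_def matrix_vector_mult_def vec_eq_iff)
  with fB that[of "matrix f $ 1"] show ?thesis
    by simp
qed

subsection \<open>Characters and cardinalities\<close>

text \<open>The nontrivial character (-1)^a of the group of order 2.\<close>

definition chi :: "bit \<Rightarrow> complex" where
  "chi a = (if a = 0 then 1 else - 1)"

lemma chi_simps [simp]: "chi 0 = 1" "chi 1 = - 1"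
  by (simp_all add: chi_def)

lemma chi_add: "chi (a + b) = chi a * chi b"
  by (cases a; cases b) simp_all

lemma chi_neq_0 [simp]: "chi a \<noteq> 0"
  by (cases a) simp_all

lemma chi_square [simp]: "chi a * chi a = 1"
  by (cases a) simp_all

lemma chi_eq_iff [simp]: "chi a = chi b \<longleftrightarrow> a = b"
  by (cases a; cases b) simp_all

lemma cnj_chi [simp]: "cnj (chi a) = chi a"
  by (cases a) simp_all

lemma chi_sum: "chi (\<Sum>i\<in>I. f i) = (\<Prod>i\<in>I. chi (f i))"
proof (induction I rule: infinite_finite_induct)
  case (insert i I)
  then show ?case
    by (simp only: sum.insert prod.insert chi_add not_False_eq_True)
qed simp_all

text \<open>Orthogonality of characters: if some \<open>v\<close> in \<open>V\<close> has product 1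
  with \<open>y\<close>, translating \<open>V\<close> by \<open>v\<close> negates every term, so the
  sum equals its own negative.\<close>

lemma sum_chi_subspace:
  fixes V :: "(bit ^ 'n::finite) set"
  assumes V: "vec.subspace V"
  shows "(\<Sum>x\<in>V. chi (bdot x y)) = (if y \<in> dual_code V then of_nat (card V) else 0)"
proof (cases "y \<in> dual_code V")
  case True
  then have "chi (bdot x y) = 1" if "x \<in> V" for x
    using that by (simp add: dual_code_def bdot_commute)
  with True show ?thesis
    by simp
next
  case False
  then obtain v where v: "v \<in> V" "bdot v y = 1"
    by (auto simp: dual_code_def bdot_commute)
  have "(\<Sum>x\<in>V. chi (bdot x y)) = (\<Sum>x\<in>V. chi (bdot (v + x) y))"
    by (rule sum.reindex_bij_witness[of _ "(+) v" "(+) v"])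
      (use v V in \<open>auto intro: vec.subspace_add\<close>)
  also have "\<dots> = - (\<Sum>x\<in>V. chi (bdot x y))"
    by (simp add: chi_add v sum_negf)
  finally show ?thesis
    using False by simp
qed

lemma dual_code_UNIV: "dual_code UNIV = {0}"
proof -
  have "x = 0" if "\<And>y. bdot x y = 0" for x :: "bit ^ 'n"
    using that[of "axis _ 1"] by (simp add: bdot_axis vec_eq_iff)
  then show ?thesis
    by (auto simp: dual_code_def)
qed

lemma sum_chi_UNIV:
  "(\<Sum>x\<in>UNIV. chi (bdot x y)) = (if y = 0 then 2 ^ CARD('n) else 0)"
  for y :: "bit ^ 'n::finite"
proof -
  have "CARD(bit) = 2"
    by (simp add: UNIV_bit)
  then show ?thesis
    using sum_chi_subspace[OF vec.subspace_UNIV, of y] by (simp add: dual_code_UNIV)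
qed

text \<open>Double counting of the sum of \<open>chi (bdot x y)\<close> over \<open>x\<close> in
  \<open>V\<close> and all \<open>y\<close>: summing over \<open>x\<close> first leaves the
  \<open>y\<close> in the dual, summing over \<open>y\<close> first leaves
  \<open>x = 0\<close>.\<close>

lemma card_mult_card_dual_code:
  fixes V :: "(bit ^ 'n::finite) set"
  assumes V: "vec.subspace V"
  shows "card V * card (dual_code V) = 2 ^ CARD('n)"
proof -
  have "(of_nat (card V * card (dual_code V)) :: complex)
      = (\<Sum>y\<in>UNIV. if y \<in> dual_code V then of_nat (card V) else 0)"
    by (simp add: sum.If_cases)
  also have "\<dots> = (\<Sum>y\<in>UNIV. \<Sum>x\<in>V. chi (bdot x y))"
    by (simp only: sum_chi_subspace[OF V])
  also have "\<dots> = (\<Sum>x\<in>V. \<Sum>y\<in>UNIV. chi (bdot y x))"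
    by (subst sum.swap) (simp add: bdot_commute)
  also have "\<dots> = (\<Sum>x\<in>V. if x = 0 then 2 ^ CARD('n) else 0)"
    by (simp only: sum_chi_UNIV)
  also have "\<dots> = of_nat (2 ^ CARD('n))"
    using vec.subspace_0[OF V] by simp
  finally show ?thesis
    by (simp only: of_nat_eq_iff)
qed

text \<open>With only two scalars, the enlarged span consists of two cosets of the old one, disjoint
  because \<open>b\<close> lies outside it.\<close>

lemma card_span_insert:
  fixes A :: "(bit ^ 'n::finite) set"
  assumes "b \<notin> vec.span A"
  shows "card (vec.span (insert b A)) = 2 * card (vec.span A)"
proof -
  have "vec.span (insert b A) = vec.span A \<union> (+) b ` vec.span A"
  proof (intro Set.set_eqI iffI)
    fix x assume "x \<in> vec.span (insert b A)"
    then obtain k where k: "x - k *s b \<in> vec.span A"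
      by (auto simp: vec.span_insert)
    then show "x \<in> vec.span A \<union> (+) b ` vec.span A"
      by (cases k) (auto intro!: image_eqI[where x = "x + b"] simp: add.commute)
  next
    fix x assume "x \<in> vec.span A \<union> (+) b ` vec.span A"
    then have "x - 0 *s b \<in> vec.span A \<or> x - 1 *s b \<in> vec.span A"
      by (auto simp: add_ac)
    then show "x \<in> vec.span (insert b A)"
      unfolding vec.span_insert by blast
  qed
  moreover have "vec.span A \<inter> (+) b ` vec.span A = {}"
  proof -
    have False if "b + x \<in> vec.span A" "x \<in> vec.span A" for x
      using vec.span_add[OF that] assms by (simp add: add_ac)
    then show ?thesis
      by blast
  qed
  ultimately show ?thesis
    by (simp add: card_Un_disjoint card_image)
qed

lemma card_span_independent:
  assumes "vec.independent (B :: (bit ^ 'n::finite) set)"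
  shows "card (vec.span B) = 2 ^ card B"
  using finite[of B] assms
proof (induction B rule: finite_induct)
  case (insert b B)
  then show ?case
    by (simp add: vec.independent_insert card_span_insert)
qed simp

subsection \<open>Orthonormal families\<close>

definition orthonormal :: "(bit ^ 'n) set \<Rightarrow> bool" where
  "orthonormal U \<longleftrightarrow> (\<forall>x\<in>U. \<forall>y\<in>U. bdot x y = (if x = y then 1 else 0))"

text \<open>Only the term \<open>v = u\<close> survives. Hence \<open>x\<close> minus its expansion
  along \<open>U\<close> is orthogonal to \<open>U\<close>.\<close>

lemma bdot_sum_orthonormal:
  fixes U :: "(bit ^ 'n::finite) set"
  assumes "orthonormal U" "u \<in> U"
  shows "bdot u (\<Sum>v\<in>U. bdot x v *s v) = bdot x u"
proof -
  have "bdot u (\<Sum>v\<in>U. bdot x v *s v) = (\<Sum>v\<in>U. bdot u (bdot x v *s v))"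
    by (rule bdot_sum_right)
  also have "\<dots> = (\<Sum>v\<in>U. if v = u then bdot x u else 0)"
  proof (rule sum.cong)
    fix v assume "v \<in> U"
    then show "bdot u (bdot x v *s v) = (if v = u then bdot x u else 0)"
      using assms by (cases "bdot x v") (auto simp: orthonormal_def)
  qed simp
  also have "\<dots> = bdot x u"
    using assms by simp
  finally show ?thesis .
qed

text \<open>
  A maximal orthonormal family spans a complement of the radical: otherwise its orthogonal
  complement in \<open>D\<close> contains either a vector \<open>w\<close> with \<open>w \<cdot> w = 1\<close>, or a hyperbolic pair
  \<open>x, y\<close>, and in the latter case some \<open>u\<close> can be traded for \<open>u + x\<close>, \<open>u + y\<close>, \<open>u + x + y\<close>.
\<close>

lemma exists_orthonormal_basis:
  fixes D :: "(bit ^ 'n::finite) set"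
  assumes D: "vec.subspace D" and h: "h \<in> D" "bdot h h = 1"
  obtains U where "U \<subseteq> D" "orthonormal U" "D \<subseteq> vec.span (dual_code D \<union> U)"
proof -
  let ?P = "\<lambda>U. U \<subseteq> D \<and> orthonormal U"
  have P1: "?P {h}"
    using h by (simp add: orthonormal_def)
  have "\<forall>V. ?P V \<longrightarrow> card V < Suc (CARD(bit ^ 'n))"
    using card_mono[OF finite subset_UNIV] by (intro allI impI le_imp_less_Suc)
  with P1 have "\<exists>U. ?P U \<and> (\<forall>V. ?P V \<longrightarrow> card V \<le> card U)"
    by (rule ex_has_greatest_nat[where P = ?P])
  then obtain U where U: "?P U" and max: "\<And>V. ?P V \<Longrightarrow> card V \<le> card U"
    by metis
  have UD: "U \<subseteq> D" and oU: "orthonormal U"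
    using U by auto
  have dotU: "bdot x y = (if x = y then 1 else 0)" if "x \<in> U" "y \<in> U" for x y
    using oU that by (auto simp: orthonormal_def)
  \<comment> \<open>Addition is subtraction here: \<open>pr x\<close> removes from \<open>x\<close>
    its component along \<open>U\<close>.\<close>
  define pr where "pr x = x + (\<Sum>u\<in>U. bdot x u *s u)" for x
  have sumD: "(\<Sum>u\<in>U. bdot x u *s u) \<in> D" for x
    using UD by (intro vec.subspace_sum[OF D] vec.subspace_scale[OF D]) auto
  have prD: "pr x \<in> D" if "x \<in> D" for x
    unfolding pr_def using vec.subspace_add[OF D that sumD] .
  have pr_orth: "bdot u (pr x) = 0" if "u \<in> U" for x u
    using bdot_sum_orthonormal[OF oU that, of x] by (simp add: pr_def bdot_commute)
  \<comment> \<open>Maximality compared with \<open>{h}\<close> makes \<open>U\<close> nonempty;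
    this \<open>u\<close> is the vector to be traded away below.\<close>
  obtain u where u: "u \<in> U"
    using max[OF P1] by fastforce
  have isotropic: "bdot w w = 0" if w: "w \<in> D" "\<And>u. u \<in> U \<Longrightarrow> bdot u w = 0" for w
  proof (rule ccontr)
    assume "bdot w w \<noteq> 0"
    then have ww: "bdot w w = 1"
      by simp
    then have "w \<notin> U"
      using w(2) by auto
    moreover have "bdot w u = 0" if "u \<in> U" for u
      using w(2)[OF that] by (simp add: bdot_commute)
    with \<open>w \<notin> U\<close> have "?P (insert w U)"
      using UD w dotU ww by (auto simp: orthonormal_def)
    ultimately show False
      using max[of "insert w U"] by simp
  qed
  have radical: "x \<in> dual_code D" if x: "x \<in> D" "\<And>u. u \<in> U \<Longrightarrow> bdot u x = 0" for x
  proof (rule ccontr)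
    assume "x \<notin> dual_code D"
    then obtain y0 where y0: "y0 \<in> D" "bdot x y0 = 1"
      by (auto simp: dual_code_def)
    \<comment> \<open>Projecting makes \<open>y0\<close> orthogonal to \<open>U\<close>; the product
      with \<open>x\<close> stays 1 because \<open>x\<close> is orthogonal to every vector
      subtracted.\<close>
    define y where "y = pr y0"
    have y: "y \<in> D" "\<And>u. u \<in> U \<Longrightarrow> bdot u y = 0"
      using prD[OF y0(1)] pr_orth by (auto simp: y_def)
    have "bdot x (\<Sum>u\<in>U. bdot y0 u *s u) = 0"
      unfolding bdot_sum_right
    proof (rule sum.neutral, rule ballI)
      fix u assume "u \<in> U"
      then show "bdot x (bdot y0 u *s u) = 0"
        using x(2)[of u] by (cases "bdot y0 u") (simp_all add: bdot_commute[of x])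
    qed
    then have xy: "bdot x y = 1"
      using y0 by (simp add: y_def pr_def)
    have xx: "bdot x x = 0" "bdot y y = 0"
      using isotropic x y by auto
    \<comment> \<open>The Gram matrix of \<open>u\<close>, \<open>x\<close>, \<open>y\<close> is 1
      plus a hyperbolic plane, which modulo 2 is congruent to the identity; \<open>T\<close> is an
      orthonormal basis witnessing this.\<close>
    define T where "T = {u + x, u + y, u + x + y}"
    have uu: "bdot u u = 1"
      using dotU u by simp
    have ux: "bdot u x = 0" "bdot x u = 0" "bdot u y = 0" "bdot y u = 0"
      using x y u bdot_commute by metis+
    have yx: "bdot y x = 1"
      using xy bdot_commute by metis
    note dots = uu ux yx xy xx
    have oT: "bdot (u + x) (u + x) = 1" "bdot (u + y) (u + y) = 1"
      "bdot (u + x + y) (u + x + y) = 1" "bdot (u + x) (u + y) = 0"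
      "bdot (u + x) (u + x + y) = 0" "bdot (u + y) (u + x + y) = 0"
      "bdot (u + y) (u + x) = 0"
      "bdot (u + x + y) (u + x) = 0" "bdot (u + x + y) (u + y) = 0"
      by (simp_all add: dots)
    have neqT: "u + x \<noteq> u + y" "u + x \<noteq> u + x + y" "u + y \<noteq> u + x + y"
      using oT by (metis zero_neq_one)+
    have VT: "bdot v t = 0" "bdot t v = 0" if "v \<in> U - {u}" "t \<in> T" for v t
    proof -
      have "bdot v u = 0" "bdot v x = 0" "bdot v y = 0"
        using that x(2) y(2) dotU[of v u] u by auto
      then show "bdot v t = 0"
        using that by (auto simp: T_def)
      then show "bdot t v = 0"
        by (simp add: bdot_commute)
    qed
    have T1: "bdot t t = 1" if "t \<in> T" for t
      using that oT by (auto simp: T_def)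
    have disj: "(U - {u}) \<inter> T = {}"
      using VT T1 by fastforce
    have oT': "orthonormal T"
      unfolding orthonormal_def T_def using oT neqT neqT[symmetric]
      by (simp only: ball_simps insert_iff empty_iff if_True if_False refl simp_thms)
    have "orthonormal ((U - {u}) \<union> T)"
      unfolding orthonormal_def
    proof (intro ballI)
      fix v w assume vw: "v \<in> (U - {u}) \<union> T" "w \<in> (U - {u}) \<union> T"
      then consider "v \<in> U" "w \<in> U" | "v \<in> T" "w \<in> T" | "v \<in> U - {u}" "w \<in> T"
        | "v \<in> T" "w \<in> U - {u}"
        by blast
      then show "bdot v w = (if v = w then 1 else 0)"
      proof cases
        case 1 then show ?thesis by (rule dotU)
      next
        case 2 then show ?thesis using oT' by (auto simp: orthonormal_def)
      next
        case 3 then show ?thesis using VT disj by auto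
      next
        case 4 then show ?thesis using VT disj by auto
      qed
    qed
    moreover have "(U - {u}) \<union> T \<subseteq> D"
      using UD u x y by (auto simp: T_def intro!: vec.subspace_add[OF D])
    ultimately have "card ((U - {u}) \<union> T) \<le> card U"
      by (intro max) auto
    \<comment> \<open>Three vectors replace the single \<open>u\<close>, so the new family has two
      more members than \<open>U\<close>.\<close>
    moreover have "card T = 3"
      using neqT by (simp add: T_def)
    ultimately show False
      using disj u card_Un_disjoint[of "U - {u}" T] by (simp add: card_Diff_singleton)
  qed
  \<comment> \<open>Each \<open>x\<close> in \<open>D\<close> is the sum of \<open>pr x\<close>, now
    known to be radical, and its expansion along \<open>U\<close>.\<close>
  have "D \<subseteq> vec.span (dual_code D \<union> U)"
  proof
    fix x assume "x \<in> D"
    then have "pr x \<in> vec.span (dual_code D \<union> U)"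
      by (intro vec.span_base UnI1 radical prD pr_orth)
    moreover have "(\<Sum>u\<in>U. bdot x u *s u) \<in> vec.span (dual_code D \<union> U)"
      by (intro vec.span_sum vec.span_scale vec.span_base UnI2)
    ultimately have "pr x + (\<Sum>u\<in>U. bdot x u *s u) \<in> vec.span (dual_code D \<union> U)"
      by (rule vec.span_add)
    then show "x \<in> vec.span (dual_code D \<union> U)"
      by (simp add: pr_def add.assoc)
  qed
  with that UD oU show ?thesis
    by blast
qed

text \<open>Each new vector is orthogonal to the span built so far but not to itself, so it lies
  outside and doubles the cardinality.\<close>

lemma card_span_orthonormal:
  fixes U :: "(bit ^ 'n::finite) set"
  assumes "orthonormal U" and C: "vec.subspace C" and "\<And>u c. u \<in> U \<Longrightarrow> c \<in> C \<Longrightarrow> bdot u c = 0"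
  shows "card (vec.span (C \<union> U)) = 2 ^ card U * card C"
  using finite[of U] assms(1,3)
proof (induction U rule: finite_induct)
  case empty
  have "vec.span C = C"
    using C vec.span_eq_iff by blast
  then show ?case
    by (simp only: Un_empty_right card.empty power_0 mult_1)
next
  case (insert u U)
  have "bdot u x = 0" if "x \<in> vec.span (C \<union> U)" for x
    using that
  proof (induction rule: vec.span_induct)
    case base
    show ?case
      by (rule vec_subspaceI) auto
  next
    case (step x)
    then show ?case
      using insert by (auto simp: orthonormal_def)
  qed
  moreover have "bdot u u = 1"
    using insert.prems by (simp add: orthonormal_def)
  ultimately have "u \<notin> vec.span (C \<union> U)"
    by auto
  then have "card (vec.span (C \<union> insert u U)) = 2 * card (vec.span (C \<union> U))"
    by (simp add: card_span_insert)
  then show ?case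
    using insert by (auto simp: orthonormal_def)
qed

subsection \<open>Pauli operators in the computational basis\<close>

text \<open>\<open>weyl c a b\<close> is \<open>c X(a) Z(b)\<close>.\<close>

definition weyl :: "complex \<Rightarrow> bit ^ 'n \<Rightarrow> bit ^ 'n \<Rightarrow> 'n::finite operator" where
  "weyl c a b = (\<chi> x y. if x = y + a then c * chi (bdot b y) else 0)"

text \<open>The sign comes from moving Z(b) past X(a').\<close>

lemma weyl_mult:
  "weyl c a b ** weyl c' a' b' = weyl (c * c' * chi (bdot b a')) (a + a') (b + b')"
proof -
  have "(\<Sum>z\<in>UNIV. (if x = z + a then c * chi (bdot b z) else 0) *
          (if z = y + a' then c' * chi (bdot b' y) else 0)) =
        (if x = y + (a + a') then c * c' * chi (bdot b a') * chi (bdot (b + b') y) else 0)"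
    for x y
  proof -
    have "(\<Sum>z\<in>UNIV. (if x = z + a then c * chi (bdot b z) else 0) *
          (if z = y + a' then c' * chi (bdot b' y) else 0)) =
        (\<Sum>z\<in>UNIV. if z = y + a' then (if x = z + a then c * chi (bdot b z) else 0) *
          (c' * chi (bdot b' y)) else 0)"
      by (rule sum.cong) auto
    then show ?thesis
      by (simp add: chi_add add_ac mult_ac)
  qed
  then show ?thesis
    by (simp add: weyl_def matrix_matrix_mult_def vec_eq_iff)
qed

text \<open>Column 0 reveals \<open>a\<close> and \<open>c\<close>, and the other nonzero entries
  reveal the functional \<open>bdot b\<close>. With \<open>c = 0\<close> the matrix would vanish and
  lose its labels.\<close>

lemma weyl_inject:
  assumes "c \<noteq> 0"
  shows "weyl c a b = weyl c' a' b' \<longleftrightarrow> c = c' \<and> a = a' \<and> b = b'"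
proof
  assume "weyl c a b = weyl c' a' b'"
  then have eq: "weyl c a b $ x $ y = weyl c' a' b' $ x $ y" for x y
    by simp
  from eq[of a 0] assms have ac: "a = a'" "c = c'"
    by (auto simp: weyl_def split: if_splits)
  have "bdot b y = bdot b' y" for y
    using eq[of "y + a" y] ac assms by (simp add: weyl_def)
  then have "b $ i = b' $ i" for i
    using bdot_axis by metis
  then show "c = c' \<and> a = a' \<and> b = b'"
    using ac by (simp add: vec_eq_iff)
qed auto

lemma mat_eq_weyl: "mat c = weyl c 0 0"
  by (simp add: mat_def weyl_def vec_eq_iff)

lemma uminus_weyl: "- weyl c a b = weyl (- c) a b"
  by (simp add: weyl_def vec_eq_iff)

text \<open>The two products carry the same labels and differ only in the signs from reordering, so
  commutation is the vanishing of the symplectic form.\<close>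

lemma commutes_weyl:
  assumes "c \<noteq> 0" "c' \<noteq> 0"
  shows "commutes (weyl c a b) (weyl c' a' b') \<longleftrightarrow> bdot b a' = bdot b' a"
  using assms by (auto simp: commutes_def weyl_mult weyl_inject add.commute)

lemma anticommutes_weyl:
  assumes "c \<noteq> 0" "c' \<noteq> 0"
  shows "anticommutes (weyl c a b) (weyl c' a' b') \<longleftrightarrow> bdot b a' + bdot b' a = 1"
proof -
  have "c * c' * chi s = - (c' * c * chi t) \<longleftrightarrow> s + t = 1" for s t
    using assms by (cases s; cases t) (simp_all add: mult.commute)
  then show ?thesis
    using assms by (auto simp: anticommutes_def weyl_mult weyl_inject uminus_weyl add.commute)
qed

subsection \<open>Tensor products\<close>

text \<open>For tensor products of gates with one nonzero entry per column: the local index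
  conditions merge into one condition on the full indices.\<close>

lemma prod_if_zero:
  assumes "finite I"
  shows "(\<Prod>i\<in>I. if P i then f i else (0::complex)) = (if \<forall>i\<in>I. P i then \<Prod>i\<in>I. f i else 0)"
  using assms by (induction I rule: finite_induct) auto

text \<open>The one-qubit version of \<open>weyl\<close>, that is, c X^a Z^b.\<close>

definition pauli1 :: "complex \<Rightarrow> bit \<Rightarrow> bit \<Rightarrow> gate1" where
  "pauli1 c a b = (\<chi> x y. if x = y + a then c * chi (b * y) else 0)"

lemma tensor_pauli1:
  "tensor (\<lambda>q. pauli1 (c q) (a q) (b q)) = weyl (\<Prod>q\<in>UNIV. c q) (\<chi> q. a q) (\<chi> q. b q)"
  by (simp add: tensor_def pauli1_def weyl_def vec_eq_iff prod_if_zero prod.distrib bdot_def chi_sum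
      if_distrib cong: if_cong)

lemma sum_bit: "(\<Sum>x\<in>UNIV. f x) = f 0 + f (1::bit)"
  by (simp add: UNIV_bit)

lemma all_bit: "(\<forall>x::bit. P x) \<longleftrightarrow> P 0 \<and> P 1"
  by (metis bit.exhaust)

lemma pauli1_eqs:
  "mat 1 = pauli1 1 0 0" "sigma_x = pauli1 1 1 0" "sigma_z = pauli1 1 0 1" "sigma_y = pauli1 \<i> 1 1"
  by (simp_all add: pauli1_def mat_def sigma_x_def sigma_z_def sigma_y_def vec_eq_iff all_bit
      matrix_matrix_mult_def sum_bit)

lemma pauli_x_eq: "pauli_x v = weyl 1 v 0"
proof -
  have "(if v $ q = 1 then sigma_x else mat 1) = pauli1 1 (v $ q) 0" for q
    by (cases "v $ q") (simp_all add: pauli1_eqs)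
  then show ?thesis
    by (simp add: pauli_x_def tensor_pauli1 flip: zero_vec_def)
qed

lemma pauli_z_eq: "pauli_z v = weyl 1 0 v"
proof -
  have "(if v $ q = 1 then sigma_z else mat 1) = pauli1 1 0 (v $ q)" for q
    by (cases "v $ q") (simp_all add: pauli1_eqs)
  then show ?thesis
    by (simp add: pauli_z_def tensor_pauli1 flip: zero_vec_def)
qed

lemma paulis_x_eq: "paulis_x = range pauli_x"
proof (intro equalityI subsetI)
  fix A :: "'a operator" assume "A \<in> paulis_x"
  then obtain P where A: "A = tensor P" and P: "P q \<in> {mat 1, sigma_x}" for q
    by (auto simp: paulis_x_def)
  have "sigma_x \<noteq> mat 1"
    by (simp add: sigma_x_def mat_def vec_eq_iff all_bit)
  then have "P q = (if (\<chi> q. if P q = sigma_x then 1 else 0) $ q = (1::bit) then sigma_x else mat 1)" for q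
    using P[of q] by auto
  then have "A = pauli_x (\<chi> q. if P q = sigma_x then 1 else 0)"
    unfolding A pauli_x_def by (rule arg_cong[OF ext])
  then show "A \<in> range pauli_x"
    by simp
next
  fix A :: "'a operator" assume "A \<in> range pauli_x"
  then obtain v where "A = pauli_x v"
    by blast
  then show "A \<in> paulis_x"
    unfolding paulis_x_def pauli_x_def by fastforce
qed

lemma paulis_z_eq: "paulis_z = range pauli_z"
proof (intro equalityI subsetI)
  fix A :: "'a operator" assume "A \<in> paulis_z"
  then obtain P where A: "A = tensor P" and P: "P q \<in> {mat 1, sigma_z}" for q
    by (auto simp: paulis_z_def)
  have "sigma_z \<noteq> mat 1"
    by (simp add: sigma_z_def mat_def vec_eq_iff all_bit)
  then have "P q = (if (\<chi> q. if P q = sigma_z then 1 else 0) $ q = (1::bit) then sigma_z else mat 1)" for q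
    using P[of q] by auto
  then have "A = pauli_z (\<chi> q. if P q = sigma_z then 1 else 0)"
    unfolding A pauli_z_def by (rule arg_cong[OF ext])
  then show "A \<in> range pauli_z"
    by simp
next
  fix A :: "'a operator" assume "A \<in> range pauli_z"
  then obtain v where "A = pauli_z v"
    by blast
  then show "A \<in> paulis_z"
    unfolding paulis_z_def pauli_z_def by fastforce
qed

subsection \<open>The Pauli group\<close>

definition phases :: "complex set" where
  "phases = {1, - 1, \<i>, - \<i>}"

lemma phases_nonzero [simp]: "c \<in> phases \<Longrightarrow> c \<noteq> 0"
  by (auto simp: phases_def)

lemma one_in_phases [simp]: "1 \<in> phases"
  by (simp add: phases_def)

lemma chi_in_phases [simp]: "chi a \<in> phases"
  by (cases a) (simp_all add: phases_def)

lemma phases_mult [intro, simp]: "c \<in> phases \<Longrightarrow> c' \<in> phases \<Longrightarrow> c * c' \<in> phases"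
  by (auto simp: phases_def)

lemma phases_inverse [intro, simp]: "c \<in> phases \<Longrightarrow> inverse c \<in> phases"
  by (auto simp: phases_def)

lemma phases_prod: "(\<And>i. i \<in> I \<Longrightarrow> f i \<in> phases) \<Longrightarrow> prod f I \<in> phases"
  by (induction I rule: infinite_finite_induct) auto

text \<open>Since Y = i X Z, the phases on single qubits can be collected into one global
  phase.\<close>

lemma paulis_eq: "paulis = {weyl c a b | c a b. c \<in> phases}"
proof (intro equalityI subsetI)
  fix A :: "'a operator" assume "A \<in> paulis"
  then have "\<exists>c P. A = mat c ** tensor P \<and> c \<in> phases \<and>
      (\<forall>q. P q \<in> {mat 1, sigma_x, sigma_y, sigma_z})"
    by (simp only: paulis_def phases_def mem_Collect_eq)
  then obtain c P where A: "A = mat c ** tensor P" and c: "c \<in> phases"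
    and P: "\<forall>q. P q \<in> {mat 1, sigma_x, sigma_y, sigma_z}"
    by (elim exE conjE) (rule that)
  have "{mat 1, sigma_x, sigma_y, sigma_z} \<subseteq> {pauli1 c a b | c a b. c \<in> phases}"
    unfolding pauli1_eqs phases_def by blast
  then have "P q \<in> {pauli1 c a b | c a b. c \<in> phases}" for q
    using P[THEN spec] by (rule subsetD)
  then have "\<forall>q. \<exists>c a b. P q = pauli1 c a b \<and> c \<in> phases"
    by (simp only: mem_Collect_eq simp_thms)
  then obtain c' a b where c': "\<And>q. c' q \<in> phases" and "\<And>q. P q = pauli1 (c' q) (a q) (b q)"
    by metis
  then have "tensor P = tensor (\<lambda>q. pauli1 (c' q) (a q) (b q))"
    by presburger
  then have "A = weyl (c * (\<Prod>q\<in>UNIV. c' q)) (\<chi> q. a q) (\<chi> q. b q)"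
    by (simp add: A tensor_pauli1 mat_eq_weyl weyl_mult)
  moreover have "c * (\<Prod>q\<in>UNIV. c' q) \<in> phases"
    using c c' by (intro phases_mult phases_prod)
  ultimately show "A \<in> {weyl c a b | c a b. c \<in> phases}"
    by blast
next
  fix A :: "'a operator" assume "A \<in> {weyl c a b | c a b. c \<in> phases}"
  then obtain c a b where A: "A = weyl c a b" and c: "c \<in> phases"
    by blast
  \<comment> \<open>A factor i on exactly the qubits carrying X Z turns them into Y; the product
    \<open>k\<close> of these factors is divided out of the global phase.\<close>
  define c' where "c' q = (if a $ q = 1 \<and> b $ q = 1 then \<i> else 1)" for q
  define P where "P = (\<lambda>q. pauli1 (c' q) (a $ q) (b $ q))"
  have P: "P q \<in> {mat 1, sigma_x, sigma_y, sigma_z}" for q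
    by (cases "a $ q"; cases "b $ q") (simp_all add: P_def c'_def pauli1_eqs)
  have c': "prod c' UNIV \<in> phases"
    by (rule phases_prod) (simp add: c'_def phases_def)
  define k where "k = prod c' UNIV"
  have k: "k \<in> phases"
    using c' by (simp add: k_def)
  have "A = mat (c * inverse k) ** tensor P"
    using phases_nonzero[OF k]
    by (simp add: A P_def tensor_pauli1 mat_eq_weyl weyl_mult k_def[symmetric] mult.assoc)
  moreover have "c * inverse k \<in> phases"
    using c k by (intro phases_mult phases_inverse)
  ultimately show "A \<in> paulis"
    using P unfolding paulis_def phases_def[symmetric] mem_Collect_eq by metis
qed

lemma weyl_in_paulis [simp]: "c \<in> phases \<Longrightarrow> weyl c a b \<in> paulis"
  by (auto simp: paulis_eq)

lemma weyl_inverse: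
  assumes "c \<noteq> 0"
  shows "weyl (inverse c * chi (bdot a b)) a b ** weyl c a b = mat 1"
  using assms by (simp add: weyl_mult mat_eq_weyl bdot_commute[of b a] mult_ac)

lemma group_pauli_group: "group (pauli_group :: 'n::finite operator monoid)"
proof (rule groupI)
  fix A :: "'n operator" assume "A \<in> carrier pauli_group"
  then obtain c a b where "A = weyl c a b" "c \<in> phases"
    by (auto simp: pauli_group_def paulis_eq)
  then show "\<exists>B\<in>carrier pauli_group. B \<otimes>\<^bsub>pauli_group\<^esub> A = \<one>\<^bsub>pauli_group\<^esub>"
    using weyl_inverse[of c a b]
    by (auto simp: pauli_group_def intro!: bexI[of _ "weyl (inverse c * chi (bdot a b)) a b"])
next
  show "\<one>\<^bsub>pauli_group\<^esub> \<in> carrier (pauli_group :: 'n operator monoid)"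
    by (simp add: pauli_group_def mat_eq_weyl)
qed (auto simp: pauli_group_def paulis_eq weyl_mult matrix_mul_assoc, metis chi_in_phases phases_mult)

text \<open>Inverses are given in coordinates, so closure under them becomes a condition on
  labels.\<close>

lemma pauli_subgroupI:
  fixes H :: "'n::finite operator set"
  assumes H: "H \<subseteq> paulis" and one: "mat 1 \<in> H"
    and mult: "\<And>A B. A \<in> H \<Longrightarrow> B \<in> H \<Longrightarrow> A ** B \<in> H"
    and inv: "\<And>c a b. c \<in> phases \<Longrightarrow> weyl c a b \<in> H \<Longrightarrow> weyl (inverse c * chi (bdot a b)) a b \<in> H"
  shows "subgroup H pauli_group"
proof -
  interpret group "pauli_group :: 'n operator monoid"
    by (rule group_pauli_group)
  show ?thesis
  proof (rule subgroupI)
    fix A assume A: "A \<in> H"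
    then obtain c a b where A': "A = weyl c a b" "c \<in> phases"
      using H by (auto simp: paulis_eq)
    let ?B = "weyl (inverse c * chi (bdot a b)) a b"
    have "inv\<^bsub>pauli_group\<^esub> A = ?B"
      using A' weyl_inverse[of c a b] by (intro inv_equality) (auto simp: pauli_group_def)
    then show "inv\<^bsub>pauli_group\<^esub> A \<in> H"
      using inv A A' by simp
  qed (use assms in \<open>auto simp: pauli_group_def\<close>)
qed

lemma generate_pauli_subset:
  assumes "subgroup H pauli_group" "G \<subseteq> H"
  shows "generate pauli_group G \<subseteq> H"
  using group.generate_subgroup_incl[OF group_pauli_group assms(2,1)] .

lemma generate_pauli_closed:
  assumes "A \<in> generate pauli_group G" "B \<in> generate pauli_group G"
  shows "A ** B \<in> generate pauli_group G"
  using generate.eng[OF assms] by (simp add: pauli_group_def)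

lemma mat_1_in_generate: "mat 1 \<in> generate pauli_group G"
  using generate.one[of pauli_group G] by (simp add: pauli_group_def)

text \<open>\<open>pauli_x\<close> turns sums into products, so the vectors it sends into the
  generated subgroup form a subspace.\<close>

lemma pauli_x_span_in_generate:
  assumes "\<And>b. b \<in> B \<Longrightarrow> pauli_x b \<in> generate pauli_group G" and "v \<in> vec.span B"
  shows "pauli_x v \<in> generate pauli_group G"
  using assms(2)
proof (induction rule: vec.span_induct)
  case base
  show ?case
  proof (rule vec_subspaceI)
    fix x y assume "x \<in> {v. pauli_x v \<in> generate pauli_group G}" "y \<in> {v. pauli_x v \<in> generate pauli_group G}"
    then show "x + y \<in> {v. pauli_x v \<in> generate pauli_group G}"
      using generate_pauli_closed[of "pauli_x x" G "pauli_x y"] by (simp add: pauli_x_eq weyl_mult)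
  qed (use mat_1_in_generate[of G] in \<open>simp add: pauli_x_eq mat_eq_weyl\<close>)
qed (use assms(1) in auto)

lemma pauli_z_span_in_generate:
  assumes "\<And>b. b \<in> B \<Longrightarrow> pauli_z b \<in> generate pauli_group G" and "v \<in> vec.span B"
  shows "pauli_z v \<in> generate pauli_group G"
  using assms(2)
proof (induction rule: vec.span_induct)
  case base
  show ?case
  proof (rule vec_subspaceI)
    fix x y assume "x \<in> {v. pauli_z v \<in> generate pauli_group G}" "y \<in> {v. pauli_z v \<in> generate pauli_group G}"
    then show "x + y \<in> {v. pauli_z v \<in> generate pauli_group G}"
      using generate_pauli_closed[of "pauli_z x" G "pauli_z y"] by (simp add: pauli_z_eq weyl_mult)
  qed (use mat_1_in_generate[of G] in \<open>simp add: pauli_z_eq mat_eq_weyl\<close>)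
qed (use assms(1) in auto)

lemma mat_phase_in_generate:
  assumes "mat \<i> \<in> generate pauli_group G" and "c \<in> phases"
  shows "mat c \<in> generate pauli_group G"
proof -
  note mult = generate_pauli_closed[of _ G "mat \<i>", OF _ assms(1)]
  have "mat (- 1) \<in> generate pauli_group G"
    using mult[OF assms(1)] by (simp add: mat_eq_weyl weyl_mult)
  moreover from mult[OF this] have "mat (- \<i>) \<in> generate pauli_group G"
    by (simp add: mat_eq_weyl weyl_mult)
  ultimately show ?thesis
    using assms mat_1_in_generate[of G] by (auto simp: phases_def)
qed

text \<open>Triviality is tested on entries: the nonzero entry in row \<open>a\<close> and column 0
  forces \<open>a $ q = 0\<close>, and flipping bit \<open>q\<close> of both indices detects
  \<open>b $ q\<close> by a sign.\<close>

lemma supp_weyl: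
  assumes "c \<noteq> 0"
  shows "supp (weyl c a b) = {q. a $ q = 1 \<or> b $ q = 1}"
proof -
  have "acts_trivially_on (weyl c a b) q \<longleftrightarrow> a $ q = 0 \<and> b $ q = 0" for q
  proof
    assume "acts_trivially_on (weyl c a b) q"
    then obtain V where V: "\<And>x y. weyl c a b $ x $ y =
        (if x $ q = y $ q then V (restrict (($) x) (- {q})) (restrict (($) y) (- {q})) else 0)"
      by (auto simp: acts_trivially_on_def)
    have a: "a $ q = 0"
      using V[of a 0] assms by (auto simp: weyl_def split: if_splits)
    let ?e = "axis q 1 :: bit ^ 'a"
    have e: "restrict (($) (x + ?e)) (- {q}) = restrict (($) x) (- {q})" for x
      by (auto simp: restrict_def axis_def)
    have "weyl c a b $ (a + ?e) $ (0 + ?e) = weyl c a b $ a $ 0"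
      unfolding V e using a by simp
    then have "chi (b $ q) = 1"
      using assms by (simp add: weyl_def bdot_axis add.commute)
    then have "b $ q = 0"
      using chi_eq_iff[of _ 0] by simp
    with a show "a $ q = 0 \<and> b $ q = 0" ..
  next
    assume ab: "a $ q = 0 \<and> b $ q = 0"
    \<comment> \<open>\<open>z\<close> fills in 0 at qubit \<open>q\<close>, so that the operator on
      the remaining qubits can be read off from entries of \<open>weyl c a b\<close> itself.\<close>
    define z where "z f = (\<chi> p. if p = q then 0 else f p)" for f :: "'a \<Rightarrow> bit"
    have 1: "x = y + a \<longleftrightarrow> x $ q = y $ q \<and> z (restrict (($) x) (- {q})) = z (restrict (($) y) (- {q})) + a" for x y
      using ab by (auto simp: vec_eq_iff z_def) (metis add.right_neutral)
    have 2: "bdot b (z (restrict (($) y) (- {q}))) = bdot b y" for y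
      unfolding bdot_def using ab by (intro sum.cong) (auto simp: z_def)
    have "weyl c a b $ x $ y = (if x $ q = y $ q then
        weyl c a b $ z (restrict (($) x) (- {q})) $ z (restrict (($) y) (- {q})) else 0)" for x y
      using 1[of x y] 2[of y] by (auto simp: weyl_def)
    then show "acts_trivially_on (weyl c a b) q"
      unfolding acts_trivially_on_def by (intro exI[of _ "\<lambda>f g. weyl c a b $ z f $ z g"] allI)
  qed
  then show ?thesis
    by (auto simp: supp_def)
qed

lemma supp_pauli_x: "supp (pauli_x v) = {q. v $ q = 1}"
  by (simp add: pauli_x_eq supp_weyl)

lemma supp_pauli_z: "supp (pauli_z v) = {q. v $ q = 1}"
  by (simp add: pauli_z_eq supp_weyl)

subsection \<open>Transversal Hadamard and phase gates\<close>

text \<open>For unitary \<open>U\<close> an intertwining relation suffices, which keeps the adjoint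
  out of the computations.\<close>

lemma conjugate_eqI:
  assumes "unitary U" "U ** A = B ** U"
  shows "conjugate U A = B"
proof -
  have "conjugate U A = B ** (U ** dagger U)"
    by (simp add: conjugate_def assms(2) matrix_mul_assoc)
  then show ?thesis
    using assms(1) by (simp add: unitary_def)
qed

text \<open>The local signs multiply to the normalized character table of the group of binary
  vectors; unitarity is then character orthogonality.\<close>

lemma tensor_hadamard:
  "tensor (\<lambda>i. hadamard) $ x $ (y :: bit ^ 'n::finite)
    = chi (bdot x y) / of_real (sqrt 2) ^ CARD('n)"
proof -
  have "hadamard $ a $ b = chi (a * b) / of_real (sqrt 2)" for a b
    by (cases a; cases b) (simp_all add: hadamard_def)
  then show ?thesis
    by (simp add: tensor_def prod_dividef bdot_def chi_sum)
qed

lemma unitary_tensor_hadamard: "unitary (tensor (\<lambda>i. hadamard) :: 'n::finite operator)"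
proof -
  let ?N = "of_real (sqrt 2) ^ CARD('n) :: complex"
  let ?H = "tensor (\<lambda>i. hadamard) :: 'n operator"
  have N: "?N * ?N = 2 ^ CARD('n)"
    by (simp flip: power_mult_distrib of_real_mult)
  have "(\<Sum>z\<in>UNIV. chi (bdot x z) / ?N * (chi (bdot z y) / ?N)) = (if x = y then 1 else 0)"
    for x y :: "bit ^ 'n"
  proof -
    have "(\<Sum>z\<in>UNIV. chi (bdot x z) / ?N * (chi (bdot z y) / ?N))
        = (\<Sum>z\<in>UNIV. chi (bdot z (x + y))) / 2 ^ CARD('n)"
      by (simp add: chi_add bdot_commute[of x] N flip: sum_divide_distrib)
    also have "\<dots> = (if x = y then 1 else 0)"
      unfolding sum_chi_UNIV vec_add_eq_0_iff by simp
    finally show ?thesis .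
  qed
  then have "?H ** ?H = mat 1"
    by (simp add: matrix_matrix_mult_def mat_def vec_eq_iff[where 'b = "bit ^ 'n"] tensor_hadamard)
  moreover have "dagger ?H = ?H"
    by (simp add: dagger_def vec_eq_iff[where 'b = "bit ^ 'n"] tensor_hadamard bdot_commute)
  ultimately show ?thesis
    by (simp add: unitary_def)
qed

text \<open>The gate exchanges X and Z, giving Z(a) X(b); restoring the order X(b) Z(a) costs the
  sign.\<close>

lemma conjugate_hadamard:
  "conjugate (tensor (\<lambda>i. hadamard)) (weyl c a b) = weyl (c * chi (bdot a b)) b a"
proof (rule conjugate_eqI[OF unitary_tensor_hadamard])
  let ?N = "of_real (sqrt 2) ^ CARD('a) :: complex"
  have "(\<Sum>z\<in>UNIV. chi (bdot x z) / ?N * (if z = y + a then c * chi (bdot b y) else 0)) =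
      (\<Sum>z\<in>UNIV. (if x = z + b then c * chi (bdot a b) * chi (bdot a z) else 0) * (chi (bdot z y) / ?N))"
    for x y
  proof -
    have "(\<Sum>z\<in>UNIV. chi (bdot x z) / ?N * (if z = y + a then c * chi (bdot b y) else 0)) =
       (\<Sum>z\<in>UNIV. if z = y + a then chi (bdot x z) / ?N * (c * chi (bdot b y)) else 0)"
      by (rule sum.cong) auto
    also have "\<dots> = chi (bdot x (y + a)) / ?N * (c * chi (bdot b y))"
      by simp
    also have "\<dots> = c * chi (bdot a b) * chi (bdot a (x + b)) * (chi (bdot (x + b) y) / ?N)"
      by (simp add: chi_add bdot_commute)
    also have "\<dots> = (\<Sum>z\<in>UNIV. if z = x + b then
        c * chi (bdot a b) * chi (bdot a z) * (chi (bdot z y) / ?N) else 0)"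
      by simp
    also have "\<dots> = (\<Sum>z\<in>UNIV. (if x = z + b then c * chi (bdot a b) * chi (bdot a z) else 0) *
        (chi (bdot z y) / ?N))"
      by (rule sum.cong) (auto simp: add.assoc)
    finally show ?thesis .
  qed
  then show "tensor (\<lambda>i. hadamard) ** weyl c a b = weyl (c * chi (bdot a b)) b a ** tensor (\<lambda>i. hadamard)"
    by (simp add: matrix_matrix_mult_def vec_eq_iff[where 'b = "bit ^ 'a"] tensor_hadamard weyl_def)
qed

text \<open>The eigenvalue of the transversal phase gate on the basis state \<open>x\<close>; for
  constant exponent 1 it is i^|x|.\<close>

definition phase_of :: "('n \<Rightarrow> int) \<Rightarrow> bit ^ 'n::finite \<Rightarrow> complex" where
  "phase_of b x = (\<Prod>q\<in>UNIV. if x $ q = 0 then 1 else \<i> powi b q)"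

lemma tensor_phase_gate:
  "tensor (\<lambda>q. phase_gate (b q)) $ x $ y = (if x = y then phase_of b x else 0)"
  by (simp add: tensor_def phase_gate_def phase_of_def prod_if_zero vec_eq_iff)

lemma phase_of_0 [simp]: "phase_of b 0 = 1"
  by (simp add: phase_of_def)

lemma i_powi_unit:
  assumes "b \<in> {- 1, 1 :: int}"
  shows "\<i> powi b \<in> {\<i>, - \<i>}"
  using assms by (auto simp: power_int_minus)

text \<open>On the overlap the sum has no phase while the two factors multiply to -1, which the
  character compensates. So \<open>phase_of\<close> is a quadratic refinement of the dot
  product.\<close>

lemma phase_of_add:
  assumes "\<And>q. b q \<in> {- 1, 1}"
  shows "phase_of b (x + y) = phase_of b x * phase_of b y * chi (bdot x y)"
proof -
  have "(if (x + y) $ q = 0 then 1 else \<i> powi b q) =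
    (if x $ q = 0 then 1 else \<i> powi b q) * (if y $ q = 0 then 1 else \<i> powi b q) * chi (x $ q * y $ q)" for q
    using i_powi_unit[OF assms[of q]] by (cases "x $ q"; cases "y $ q") auto
  then show ?thesis
    by (simp only: phase_of_def bdot_def chi_sum prod.distrib)
qed

lemma cnj_phase_of: "phase_of b x * cnj (phase_of b x) = 1"
proof -
  have "phase_of b x * cnj (phase_of b x) = (\<Prod>q\<in>UNIV.
     (if x $ q = 0 then 1 else \<i> powi b q) * cnj (if x $ q = 0 then 1 else \<i> powi b q))"
    by (simp add: phase_of_def prod.distrib)
  also have "\<dots> = 1"
    by (rule prod.neutral) (simp add: complex_norm_square[symmetric] norm_power_int)
  finally show ?thesis .
qed

lemma unitary_tensor_phase_gate: "unitary (tensor (\<lambda>q. phase_gate (b q)) :: 'n::finite operator)"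
proof -
  have "(\<Sum>z\<in>UNIV. (if x = z then phase_of b x else 0) * cnj (if y = z then phase_of b y else 0))
      = (if x = y then 1 else 0)" for x y
  proof -
    have "(\<Sum>z\<in>UNIV. (if x = z then phase_of b x else 0) * cnj (if y = z then phase_of b y else 0))
      = (\<Sum>z\<in>UNIV. if x = z then (if y = x then phase_of b x * cnj (phase_of b x) else 0) else 0)"
      by (rule sum.cong) auto
    then show ?thesis
      by (simp add: cnj_phase_of)
  qed
  moreover have "(\<Sum>z\<in>UNIV. cnj (if z = x then phase_of b z else 0) * (if z = y then phase_of b z else 0))
      = (if x = y then 1 else 0)" for x y
  proof -
    have "(\<Sum>z\<in>UNIV. cnj (if z = x then phase_of b z else 0) * (if z = y then phase_of b z else 0))
      = (\<Sum>z\<in>UNIV. if z = x then (if x = y then phase_of b x * cnj (phase_of b x) else 0) else 0)"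
      by (rule sum.cong) auto
    then show ?thesis
      by (simp add: cnj_phase_of)
  qed
  ultimately show ?thesis
    by (simp add: unitary_def matrix_matrix_mult_def mat_def dagger_def
        vec_eq_iff[where 'b = "bit ^ 'n"] tensor_phase_gate)
qed

text \<open>On each qubit of \<open>u\<close>, X becomes a phase times X Z; globally this is the
  addition rule of \<open>phase_of\<close>, whose sign becomes the extra Z(u).\<close>

lemma conjugate_phase_gate:
  assumes "\<And>q. b q \<in> {- 1, 1}"
  shows "conjugate (tensor (\<lambda>q. phase_gate (b q))) (weyl c u v) = weyl (c * phase_of b u) u (u + v)"
proof (rule conjugate_eqI[OF unitary_tensor_phase_gate])
  have "(\<Sum>z\<in>UNIV. (if x = z then phase_of b x else 0) * (if z = y + u then c * chi (bdot v y) else 0)) =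
     (\<Sum>z\<in>UNIV. (if x = z + u then c * phase_of b u * chi (bdot (u + v) z) else 0) *
       (if z = y then phase_of b z else 0))" for x y
  proof -
    have "(\<Sum>z\<in>UNIV. (if x = z then phase_of b x else 0) * (if z = y + u then c * chi (bdot v y) else 0)) =
      (\<Sum>z\<in>UNIV. if x = z then (if x = y + u then phase_of b (y + u) * (c * chi (bdot v y)) else 0) else 0)"
      by (rule sum.cong) auto
    also have "\<dots> = (\<Sum>z\<in>UNIV. if z = y then
        (if x = y + u then c * phase_of b u * chi (bdot (u + v) y) * phase_of b y else 0) else 0)"
      by (simp add: phase_of_add[OF assms] chi_add bdot_commute mult_ac)
    also have "\<dots> = (\<Sum>z\<in>UNIV. (if x = z + u then c * phase_of b u * chi (bdot (u + v) z) else 0) *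
       (if z = y then phase_of b z else 0))"
      by (rule sum.cong) auto
    finally show ?thesis .
  qed
  then show "tensor (\<lambda>q. phase_gate (b q)) ** weyl c u v =
      weyl (c * phase_of b u) u (u + v) ** tensor (\<lambda>q. phase_gate (b q))"
    by (simp add: matrix_matrix_mult_def vec_eq_iff[where 'b = "bit ^ 'a"] tensor_phase_gate weyl_def)
qed

text \<open>Changing the exponent from 1 to -1 negates the phase of a qubit, so choosing signs means
  multiplying by an arbitrary character.\<close>

lemma phase_of_signs:
  "phase_of (\<lambda>q. if t $ q = 0 then 1 else - 1) x = chi (bdot t x) * phase_of (\<lambda>q. 1) x"
proof -
  have "(if x $ q = 0 then 1 else \<i> powi (if t $ q = 0 then 1 else - 1)) =
      chi (t $ q * x $ q) * (if x $ q = 0 then 1 else \<i> powi 1)" for q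
    by (cases "x $ q"; cases "t $ q") (simp_all add: power_int_minus)
  then show ?thesis
    by (simp only: phase_of_def bdot_def chi_sum prod.distrib)
qed

text \<open>The addition rule at \<open>x = y\<close>. Phases are thus signs on isotropic vectors
  and square roots of -1 on the others.\<close>

lemma phase_of_square:
  assumes "\<And>q. b q \<in> {- 1, 1}"
  shows "phase_of b x * phase_of b x = chi (bdot x x)"
proof -
  have "phase_of b x * phase_of b x * chi (bdot x x) = 1"
    using phase_of_add[OF assms, where x = x and y = x] by simp
  then show ?thesis
    by (cases "bdot x x") (simp_all add: minus_equation_iff)
qed

subsection \<open>Self-dual CSS codes\<close>

definition css_group :: "(bit ^ 'n::finite) set \<Rightarrow> 'n operator set" where
  "css_group C = {weyl 1 u v | u v. u \<in> C \<and> v \<in> C}"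

lemma weyl_in_css_group:
  assumes "c \<noteq> 0"
  shows "weyl c a b \<in> css_group C \<longleftrightarrow> c = 1 \<and> a \<in> C \<and> b \<in> C"
  by (auto simp: css_group_def weyl_inject[OF assms])

text \<open>Products with a fixed vector are linear, so generators suffice. This identifies the
  parity check code with the dual of the row space.\<close>

lemma dual_code_span: "dual_code (vec.span G) = {x. \<forall>g\<in>G. bdot g x = 0}"
proof -
  have "bdot x y = 0" if "\<forall>g\<in>G. bdot g x = 0" "y \<in> vec.span G" for x y
    using that(2)
  proof (induction rule: vec.span_induct)
    case base
    show ?case
      by (rule vec_subspaceI) auto
  qed (use that in \<open>auto simp: bdot_commute\<close>)
  then show ?thesis
    by (auto simp: dual_code_def bdot_commute intro: vec.span_base)
qed

text \<open>Self-orthogonality removes the reordering signs, so the phase-free products form a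
  group; conversely, their X and Z parts are generated separately.\<close>

lemma css_stabilizer_eq:
  assumes C: "C = vec.span (g ` {1..r})" and iso: "C \<subseteq> dual_code C"
  shows "css_stabilizer r g = css_group C"
proof
  have sub: "vec.subspace C"
    by (simp add: C)
  have iso': "bdot u v = 0" if "u \<in> C" "v \<in> C" for u v
    using iso that by (auto simp: dual_code_def)
  have "subgroup (css_group C) pauli_group"
  proof (rule pauli_subgroupI)
    show "mat 1 \<in> css_group C"
      using vec.subspace_0[OF sub] by (auto simp: css_group_def mat_eq_weyl)
  next
    fix A B assume "A \<in> css_group C" "B \<in> css_group C"
    then obtain u v u' v' where "A = weyl 1 u v" "B = weyl 1 u' v'" "u \<in> C" "v \<in> C" "u' \<in> C" "v' \<in> C"
      unfolding css_group_def mem_Collect_eq by metis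
    moreover from this have "A ** B = weyl 1 (u + u') (v + v')"
      by (simp add: weyl_mult iso')
    ultimately show "A ** B \<in> css_group C"
      using vec.subspace_add[OF sub] by (auto simp: css_group_def)
  next
    fix c and a b :: "bit ^ 'a" assume c: "c \<in> phases" and w: "weyl c a b \<in> css_group C"
    then have "c = 1" "a \<in> C" "b \<in> C"
      by (simp_all add: weyl_in_css_group)
    then show "weyl (inverse c * chi (bdot a b)) a b \<in> css_group C"
      by (simp add: iso' weyl_in_css_group)
  qed (auto simp: css_group_def)
  moreover have "pauli_x v \<in> css_group C" "pauli_z v \<in> css_group C" if "v \<in> C" for v
    using that vec.subspace_0[OF sub] by (auto simp: css_group_def pauli_x_eq pauli_z_eq)
  then have "(\<lambda>i. pauli_x (g i)) ` {1..r} \<union> (\<lambda>i. pauli_z (g i)) ` {1..r} \<subseteq> css_group C"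
    using vec.span_superset[of "g ` {1..r}"] by (auto simp: C)
  ultimately show "css_stabilizer r g \<subseteq> css_group C"
    unfolding css_stabilizer_def by (rule generate_pauli_subset)
next
  show "css_group C \<subseteq> css_stabilizer r g"
  proof
    fix A assume "A \<in> css_group C"
    then obtain u v where A: "A = pauli_x u ** pauli_z v" "u \<in> C" "v \<in> C"
      by (auto simp: css_group_def pauli_x_eq pauli_z_eq weyl_mult)
    let ?G = "(\<lambda>i. pauli_x (g i)) ` {1..r} \<union> (\<lambda>i. pauli_z (g i)) ` {1..r}"
    have "pauli_x u \<in> generate pauli_group ?G"
      using A(2) unfolding C by (rule pauli_x_span_in_generate[rotated]) (auto intro: generate.incl)
    moreover have "pauli_z v \<in> generate pauli_group ?G"
      using A(3) unfolding C by (rule pauli_z_span_in_generate[rotated]) (auto intro: generate.incl)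
    ultimately show "A \<in> css_stabilizer r g"
      unfolding css_stabilizer_def A(1) by (rule generate_pauli_closed)
  qed
qed

text \<open>Testing against X(u) Z(v) with \<open>u = 0\<close> or \<open>v = 0\<close> separates
  the conditions on \<open>a\<close> and \<open>b\<close>; this is where \<open>0\<close> in
  \<open>C\<close> enters.\<close>

lemma centralizer_css_group:
  assumes "0 \<in> C"
  shows "centralizer (css_group C) =
    {weyl c a b | c a b. c \<in> phases \<and> a \<in> dual_code C \<and> b \<in> dual_code C}"
proof -
  have "(\<forall>s\<in>css_group C. commutes (weyl c a b) s) \<longleftrightarrow> a \<in> dual_code C \<and> b \<in> dual_code C"
    if "c \<in> phases" for c a b
  proof -
    have "(\<forall>s\<in>css_group C. commutes (weyl c a b) s) \<longleftrightarrow>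
        (\<forall>u\<in>C. \<forall>v\<in>C. commutes (weyl c a b) (weyl 1 u v))"
      by (auto simp: css_group_def)
    also have "\<dots> \<longleftrightarrow> (\<forall>u\<in>C. \<forall>v\<in>C. bdot b u = bdot v a)"
      using that by (simp add: commutes_weyl)
    also have "\<dots> \<longleftrightarrow> a \<in> dual_code C \<and> b \<in> dual_code C"
      using assms by (auto simp: dual_code_def bdot_commute dest: bspec[of C _ 0])
    finally show ?thesis .
  qed
  then show ?thesis
    by (auto simp: centralizer_def paulis_eq) (intro exI conjI, rule refl)
qed

lemma weyl_in_centralizer:
  assumes "0 \<in> C" "c \<in> phases"
  shows "weyl c a b \<in> centralizer (css_group C) \<longleftrightarrow> a \<in> dual_code C \<and> b \<in> dual_code C"
  unfolding centralizer_css_group[OF assms(1)]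
  using assms(2) by (auto simp: weyl_inject)

lemma subgroup_centralizer_css_group:
  assumes "0 \<in> C"
  shows "subgroup (centralizer (css_group C)) pauli_group"
proof (rule pauli_subgroupI)
  note sub = subspace_dual_code[of C]
  show "centralizer (css_group C) \<subseteq> paulis"
    by (auto simp: centralizer_def)
  show "mat 1 \<in> centralizer (css_group C)"
    using vec.subspace_0[OF sub] by (simp add: mat_eq_weyl weyl_in_centralizer assms)
  fix A B assume "A \<in> centralizer (css_group C)" "B \<in> centralizer (css_group C)"
  then obtain c a b c' a' b' where "A = weyl c a b" "B = weyl c' a' b'" "c \<in> phases" "c' \<in> phases"
    "a \<in> dual_code C" "a' \<in> dual_code C" "b \<in> dual_code C" "b' \<in> dual_code C"
    unfolding centralizer_css_group[OF assms] mem_Collect_eq by metis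
  then show "A ** B \<in> centralizer (css_group C)"
    using vec.subspace_add[OF sub] by (simp add: weyl_mult weyl_in_centralizer assms)
qed (simp add: weyl_in_centralizer assms)

section \<open>Symplectic bases from orthonormal families\<close>

lemma bdot_scale_right [simp]: "bdot a (c *s b) = c * bdot a b"
  by (cases c) simp_all

text \<open>X(u_i) and Z(u_j) commute up to the sign of u_i . u_j, so orthonormality is the required
  commutation pattern. By the spanning condition, the X and Z parts of a centralizing Pauli operator
  are generated independently.\<close>

lemma symplectic_basis_orthonormal:
  assumes C: "vec.subspace C" "C \<subseteq> dual_code C" and uD: "\<And>j. j \<in> {1..k} \<Longrightarrow> u j \<in> dual_code C"
    and u: "\<And>i j. i \<in> {1..k} \<Longrightarrow> j \<in> {1..k} \<Longrightarrow> bdot (u i) (u j) = (if i = j then 1 else 0)"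
    and span: "dual_code C \<subseteq> vec.span (C \<union> u ` {1..k})"
  shows "symplectic_basis (css_group C) k (\<lambda>j. pauli_x (u j)) (\<lambda>j. pauli_z (u j))"
proof -
  let ?S = "css_group C"
  let ?X = "(\<lambda>j. pauli_x (u j)) ` {1..k}" and ?Z = "(\<lambda>j. pauli_z (u j)) ` {1..k}"
  let ?G = "?X \<union> ?Z \<union> ?S \<union> {mat \<i>}"
  have 0: "0 \<in> C" "0 \<in> dual_code C"
    using vec.subspace_0 C subspace_dual_code by auto
  note cen = weyl_in_centralizer[OF 0(1)]
  have X: "?X \<subseteq> centralizer ?S" and Z: "?Z \<subseteq> centralizer ?S"
    using uD 0 by (auto simp: pauli_x_eq pauli_z_eq cen)
  have "A \<in> centralizer ?S" if A: "A \<in> ?S" for A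
  proof -
    obtain v w where "A = weyl 1 v w" "v \<in> C" "w \<in> C"
      using A unfolding css_group_def mem_Collect_eq by metis
    then show ?thesis
      using C(2) by (auto simp: cen)
  qed
  moreover have "mat \<i> \<in> centralizer ?S"
    unfolding mat_eq_weyl by (subst cen) (simp_all add: 0 phases_def)
  ultimately have G: "?G \<subseteq> centralizer ?S"
    using X Z by blast
  have "generate pauli_group ?G = centralizer ?S"
  proof
    show "generate pauli_group ?G \<subseteq> centralizer ?S"
      by (rule generate_pauli_subset[OF subgroup_centralizer_css_group[OF 0(1)] G])
    show "centralizer ?S \<subseteq> generate pauli_group ?G"
    proof
      fix A assume "A \<in> centralizer ?S"
      then obtain c a b where A: "A = weyl c a b" "c \<in> phases" "a \<in> dual_code C" "b \<in> dual_code C"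
        unfolding centralizer_css_group[OF 0(1)] mem_Collect_eq by metis
      have S: "pauli_x v \<in> ?S" "pauli_z v \<in> ?S" if "v \<in> C" for v
        using that 0(1) by (auto simp: pauli_x_eq pauli_z_eq weyl_in_css_group)
      have inG: "B \<in> generate pauli_group ?G" if "B \<in> ?G" for B
        using that by (rule generate.incl)
      have "pauli_x v \<in> generate pauli_group ?G" if "v \<in> C \<union> u ` {1..k}" for v
        using that S(1) by (intro inG) blast
      then have x: "pauli_x a \<in> generate pauli_group ?G"
        by (rule pauli_x_span_in_generate[OF _ subsetD[OF span A(3)]])
      have "pauli_z v \<in> generate pauli_group ?G" if "v \<in> C \<union> u ` {1..k}" for v
        using that S(2) by (intro inG) blast
      then have z: "pauli_z b \<in> generate pauli_group ?G"
        by (rule pauli_z_span_in_generate[OF _ subsetD[OF span A(4)]])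
      have c: "mat c \<in> generate pauli_group ?G"
        by (rule mat_phase_in_generate[OF inG A(2)]) simp
      have "A = mat c ** (pauli_x a ** pauli_z b)"
        by (simp add: A(1) pauli_x_eq pauli_z_eq mat_eq_weyl weyl_mult)
      then show "A \<in> generate pauli_group ?G"
        using generate_pauli_closed[OF c generate_pauli_closed[OF x z]] by simp
    qed
  qed
  then show ?thesis
    using X Z u by (auto simp: symplectic_basis_def pauli_x_eq pauli_z_eq commutes_weyl anticommutes_weyl)
qed

section \<open>Transversal gates acting on the code\<close>

lemma eq_mod_refl:
  assumes "0 \<in> C"
  shows "eq_mod (css_group C) A A"
proof -
  have "mat 1 \<in> css_group C"
    using assms by (simp add: mat_eq_weyl weyl_in_css_group)
  then show ?thesis
    unfolding eq_mod_def by (intro bexI[of _ "mat 1"]) simp_all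
qed

text \<open>For conjugation by either gate: it suffices that no phase appears and that the induced
  map on labels sends pairs from \<open>C\<close> onto pairs from \<open>C\<close>.\<close>

lemma image_css_group:
  assumes "\<And>u v. u \<in> C \<Longrightarrow> v \<in> C \<Longrightarrow> F (weyl 1 u v) = weyl 1 (f u v) (f' u v)"
    and "\<And>u v. u \<in> C \<Longrightarrow> v \<in> C \<Longrightarrow> f u v \<in> C \<and> f' u v \<in> C"
    and "\<And>u v. u \<in> C \<Longrightarrow> v \<in> C \<Longrightarrow> \<exists>u'\<in>C. \<exists>v'\<in>C. f u' v' = u \<and> f' u' v' = v"
  shows "F ` css_group C = css_group C"
proof (intro equalityI subsetI)
  fix A assume "A \<in> F ` css_group C"
  then obtain u v where "A = F (weyl 1 u v)" "u \<in> C" "v \<in> C"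
    unfolding css_group_def by blast
  then show "A \<in> css_group C"
    using assms(1,2) by (simp add: weyl_in_css_group)
next
  fix A assume "A \<in> css_group C"
  then obtain u v where "A = weyl 1 u v" "u \<in> C" "v \<in> C"
    unfolding css_group_def by blast
  moreover from assms(3)[OF this(2,3)] obtain u' v' where "u' \<in> C" "v' \<in> C" "f u' v' = u" "f' u' v' = v"
    by blast
  moreover from this have "weyl 1 u' v' \<in> css_group C" "F (weyl 1 u' v') = weyl 1 u v"
    using assms(1) by (simp_all add: weyl_in_css_group)
  ultimately show "A \<in> F ` css_group C"
    by (metis imageI)
qed

text \<open>
  Conjugation by the transversal phase gate with signs \<open>(-1)^t\<close> maps \<open>X(v)\<close> to
  \<open>i^|v| (-1)^(t \<cdot> v) X(v) Z(v)\<close>.  On the radical \<open>i^|v|\<close> is a sign, which \<open>t\<close> cancels on a basis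
  and hence everywhere; adding multiples of the \<open>u j\<close> to \<open>t\<close> then adjusts the signs on the
  logical operators without affecting the radical.
\<close>

lemma exists_transversal_signs:
  fixes u :: "nat \<Rightarrow> bit ^ 'n::finite"
  assumes G: "vec.independent G" and C: "C = vec.span G" "C \<subseteq> dual_code C"
    and uD: "\<And>j. j \<in> {1..k} \<Longrightarrow> u j \<in> dual_code C"
    and u: "\<And>i j. i \<in> {1..k} \<Longrightarrow> j \<in> {1..k} \<Longrightarrow> bdot (u i) (u j) = (if i = j then 1 else 0)"
    and a: "\<And>j. j \<in> {1..k} \<Longrightarrow> a j \<in> {- 1, 1}"
  obtains b :: "'n \<Rightarrow> int" where "\<And>q. b q \<in> {- 1, 1}"
    "\<And>v. v \<in> C \<Longrightarrow> phase_of b v = 1" "\<And>j. j \<in> {1..k} \<Longrightarrow> phase_of b (u j) = \<i> powi a j"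
proof -
  define p where "p = phase_of (\<lambda>q::'n. 1)"
  have pp: "p x * p x = chi (bdot x x)" for x
    unfolding p_def by (rule phase_of_square) simp
  obtain t0 where t0: "\<And>x. x \<in> G \<Longrightarrow> bdot t0 x = (if p x = 1 then 0 else 1)"
    using exists_bdot_eq[OF G, of "\<lambda>x. if p x = 1 then 0 else 1"] by blast
  \<comment> \<open>\<open>s j\<close> records whether \<open>t0\<close> alone yields the wrong one
    of the two roots of -1 at \<open>u j\<close>.\<close>
  define s where "s j = (if chi (bdot t0 (u j)) * p (u j) = \<i> powi a j then 0 else 1 :: bit)" for j
  define t where "t = t0 + (\<Sum>j\<in>{1..k}. s j *s u j)"
  define b where "b q = (if t $ q = 0 then 1 else - 1 :: int)" for q
  have b: "b q \<in> {- 1, 1}" for q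
    by (simp add: b_def)
  have pb: "phase_of b x = chi (bdot t x) * p x" for x
    unfolding b_def p_def by (rule phase_of_signs)
  have iso: "bdot v w = 0" if "v \<in> C" "w \<in> C" for v w
    using C(2) that by (auto simp: dual_code_def)
  have uC: "bdot v (u j) = 0" if "v \<in> C" "j \<in> {1..k}" for v j
    using uD[OF that(2)] that(1) by (auto simp: dual_code_def bdot_commute)
  have "phase_of b v = 1" if "v \<in> C" for v
  proof -
    have "v \<in> vec.span G"
      using that by (simp add: C)
    \<comment> \<open>Membership in \<open>C\<close> is carried along because the phase is
      multiplicative only on orthogonal vectors.\<close>
    then have "v \<in> C \<and> phase_of b v = 1"
    proof (induction rule: vec.span_induct)
      case base
      show ?case
      proof (rule vec_subspaceI)
        show "0 \<in> {v. v \<in> C \<and> phase_of b v = 1}"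
          by (simp add: C vec.span_zero)
      next
        fix x y assume "x \<in> {v. v \<in> C \<and> phase_of b v = 1}" "y \<in> {v. v \<in> C \<and> phase_of b v = 1}"
        then show "x + y \<in> {v. v \<in> C \<and> phase_of b v = 1}"
          by (simp add: phase_of_add[OF b] iso) (simp add: C vec.span_add)
      qed
    next
      case (step v)
      then have v: "v \<in> C"
        by (simp add: C vec.span_base)
      have "bdot v t = bdot v t0"
        by (simp add: t_def bdot_sum_right uC[OF v])
      then have "chi (bdot t v) = (if p v = 1 then 1 else - 1)"
        using t0[OF step] by (simp add: bdot_commute)
      moreover have "p v = 1 \<or> p v = - 1"
        using pp[of v] iso[OF v v] by (simp add: square_eq_1_iff)
      ultimately show ?case
        using v by (auto simp: pb)
    qed
    then show ?thesis ..
  qed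
  moreover have "phase_of b (u j) = \<i> powi a j" if j: "j \<in> {1..k}" for j
  proof -
    have "bdot (u j) (\<Sum>i\<in>{1..k}. s i *s u i) = (\<Sum>i\<in>{1..k}. if i = j then s j else 0)"
      unfolding bdot_sum_right by (rule sum.cong) (use u j in auto)
    then have "bdot t (u j) = bdot t0 (u j) + s j"
      using j by (simp add: t_def bdot_commute[of _ "u j"])
    then have eq: "phase_of b (u j) = chi (s j) * (chi (bdot t0 (u j)) * p (u j))"
      by (simp add: pb chi_add)
    have "p (u j) * p (u j) = - 1"
      using pp[of "u j"] u[OF j j] by simp
    then have "(p (u j) - \<i>) * (p (u j) + \<i>) = 0"
      by (simp add: algebra_simps)
    then have "p (u j) \<in> {\<i>, - \<i>}"
      by (auto simp: eq_neg_iff_add_eq_0)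
    then have "chi (bdot t0 (u j)) * p (u j) \<in> {\<i>, - \<i>}"
      by (cases "bdot t0 (u j)") auto
    then show ?thesis
      using i_powi_unit[OF a[OF j]] unfolding eq s_def by (auto split: if_splits)
  qed
  ultimately show ?thesis
    using that b by blast
qed

text \<open>Both gates act exactly as required on the chosen representatives, so equality modulo
  stabilizers holds by reflexivity.\<close>

lemma multilevel_compatible_orthonormal:
  fixes u :: "nat \<Rightarrow> bit ^ 'n::finite"
  assumes G: "vec.independent G" and C: "C = vec.span G" "C \<subseteq> dual_code C"
    and uD: "\<And>j. j \<in> {1..k} \<Longrightarrow> u j \<in> dual_code C"
    and u: "\<And>i j. i \<in> {1..k} \<Longrightarrow> j \<in> {1..k} \<Longrightarrow> bdot (u i) (u j) = (if i = j then 1 else 0)"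
    and XZ: "\<And>j. j \<in> {1..k} \<Longrightarrow> X j = pauli_x (u j)" "\<And>j. j \<in> {1..k} \<Longrightarrow> Z j = pauli_z (u j)"
  shows "multilevel_compatible (css_group C) k X Z"
proof -
  have sub: "vec.subspace C" and 0: "0 \<in> C"
    by (simp_all add: C vec.span_zero)
  note refl = eq_mod_refl[OF 0]
  have iso: "bdot v w = 0" if "v \<in> C" "w \<in> C" for v w
    using C(2) that by (auto simp: dual_code_def)
  have "conjugate (tensor (\<lambda>i. hadamard)) ` css_group C = css_group C"
    by (rule image_css_group[where f = "\<lambda>u v. v" and f' = "\<lambda>u v. u"])
      (auto simp: conjugate_hadamard iso)
  then have "implements_logical (css_group C) k X Z (\<lambda>j. logical_hadamard) (tensor (\<lambda>i. hadamard))"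
    by (simp add: implements_logical_def logical_operator_def unitary_tensor_hadamard XZ
        logical_hadamard_def pauli_x_eq pauli_z_eq conjugate_hadamard refl)
  moreover have "\<exists>b. (\<forall>i. b i \<in> {- 1, 1}) \<and> implements_logical (css_group C) k X Z
      (\<lambda>j. logical_phase (a j)) (tensor (\<lambda>i. phase_gate (b i)))"
    if a: "\<forall>j\<in>{1..k}. a j \<in> {- 1, 1}" for a
  proof -
    obtain b :: "'n \<Rightarrow> int" where b: "\<And>q. b q \<in> {- 1, 1}"
      and bC: "\<And>v. v \<in> C \<Longrightarrow> phase_of b v = 1"
      and bu: "\<And>j. j \<in> {1..k} \<Longrightarrow> phase_of b (u j) = \<i> powi a j"
      using exists_transversal_signs[OF G C uD u, of k a] a by metis
    note conj = conjugate_phase_gate[OF b]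
    have "conjugate (tensor (\<lambda>i. phase_gate (b i))) ` css_group C = css_group C"
    proof (rule image_css_group[where f = "\<lambda>u v. u" and f' = "\<lambda>u v. u + v"])
      fix v w assume vw: "v \<in> C" "w \<in> C"
      then show "v \<in> C \<and> v + w \<in> C"
        using vec.subspace_add[OF sub] by blast
      \<comment> \<open>The label map from (u, v) to (u, u + v) is its own inverse.\<close>
      then show "\<exists>v'\<in>C. \<exists>w'\<in>C. v' = v \<and> v' + w' = w"
        by (intro bexI[of _ v] bexI[of _ "v + w"]) auto
    qed (simp add: conj bC)
    then have "implements_logical (css_group C) k X Z
        (\<lambda>j. logical_phase (a j)) (tensor (\<lambda>i. phase_gate (b i)))"
      by (simp add: implements_logical_def logical_operator_def unitary_tensor_phase_gate XZ
          logical_phase_def pauli_x_eq pauli_z_eq conj bu mat_eq_weyl weyl_mult refl)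
    then show ?thesis
      using b by blast
  qed
  ultimately show ?thesis
    by (simp add: multilevel_compatible_def)
qed

section \<open>Equivalence of the four statements\<close>

lemma exists_non_isotropic_generator:
  assumes "x \<in> vec.span (A \<union> B)" "bdot x x = 1" "\<And>a. a \<in> A \<Longrightarrow> bdot a a = 0"
  shows "\<exists>b\<in>B. bdot b b = 1"
proof (rule ccontr)
  assume "\<not> (\<exists>b\<in>B. bdot b b = 1)"
  with assms(3) have "A \<union> B \<subseteq> {x. bdot x x = 0}"
    by auto
  then have "vec.span (A \<union> B) \<subseteq> {x. bdot x x = 0}"
    using subspace_isotropic by (rule vec.span_minimal)
  with assms(1,2) show False
    by auto
qed

theorem theorem1:
  fixes D :: "(bit ^ 'n::finite) set"
    and g h :: "nat \<Rightarrow> bit ^ 'n"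
    and r k d :: nat
    and S :: "'n operator set"
  assumes "k \<ge> 1"
    and "CARD('n) = k + 2 * r"
    and "dual_code D \<subset> D"
    and "parity_check r g D"
    and "dual_code D = vec.span (g ` {1..r})"
    and "D = vec.span (g ` {1..r} \<union> h ` {1..k})"
    and "S = css_stabilizer r g"
    and "d = code_distance S"
  defines "s1 \<equiv> \<exists>j\<in>{1..k}. bdot (h j) (h j) = 1"
    and "s2 \<equiv> \<exists>Lx\<in>paulis_x. \<exists>Lz\<in>paulis_z. hyperbolic_pair S Lx Lz \<and> supp Lx = supp Lz"
    and "s3 \<equiv> \<exists>X Z. symplectic_basis S k X Z \<and>
                X ` {1..k} \<subset> paulis_x \<and> Z ` {1..k} \<subset> paulis_z \<and>
                (\<forall>j\<in>{1..k}. supp (X j) = supp (Z j))"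
    and "s4 \<equiv> \<exists>X Z. symplectic_basis S k X Z \<and> multilevel_compatible S k X Z"
  shows "(s1 \<longleftrightarrow> s2) \<and> (s2 \<longleftrightarrow> s3) \<and> (s3 \<longleftrightarrow> s4)"
proof -
  define C where "C = dual_code D"
  have C: "C = vec.span (g ` {1..r})" "vec.subspace C" "0 \<in> C"
    using assms(5) by (simp_all add: C_def vec.span_zero)
  have indep: "vec.independent (g ` {1..r})" and inj: "inj_on g {1..r}"
    using assms(4) by (simp_all add: parity_check_def)
  \<comment> \<open>The parity check rows span \<open>C\<close>, so \<open>C\<close> is both the row
    space and the radical of \<open>D\<close>.\<close>
  have D: "D = dual_code C"
    using assms(4) unfolding C(1) dual_code_span by (auto simp: parity_check_def)
  have iso: "C \<subseteq> dual_code C"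
    using assms(3) D C_def by blast
  have S: "S = css_group C"
    using assms(7) css_stabilizer_eq[OF C(1) iso] by simp
  have subD: "vec.subspace D"
    unfolding D by (rule subspace_dual_code)
  have CD: "bdot c x = 0" "bdot x c = 0" if "c \<in> C" "x \<in> D" for c x
    using that by (auto simp: C_def dual_code_def bdot_commute)
  have g0: "bdot c c = 0" if "c \<in> g ` {1..r}" for c
    using that vec.span_base[OF that] iso D CD(1) unfolding C(1) by blast
  \<comment> \<open>The rows are self-orthogonal, so a vector of \<open>D\<close> with self-product
    1 must involve such an \<open>h j\<close>; both implications back to \<open>s1\<close> end
    here.\<close>
  have odd_s1: s1 if "x \<in> D" "bdot x x = 1" for x
    using exists_non_isotropic_generator[of x "g ` {1..r}" "h ` {1..k}"] that g0 assms(6)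
    unfolding s1_def by auto
  have s13: s3 if s1
  proof -
    obtain j where j: "j \<in> {1..k}" "bdot (h j) (h j) = 1"
      using \<open>s1\<close> unfolding s1_def by blast
    have "h j \<in> D"
      unfolding assms(6) using j(1) by (intro vec.span_base) blast
    then obtain U where U: "U \<subseteq> D" "orthonormal U" "D \<subseteq> vec.span (C \<union> U)"
      using exists_orthonormal_basis[OF subD _ j(2)] unfolding C_def by metis
    \<comment> \<open>Counting fixes the number of basis vectors: |D| = 2^|U| |C|, |C| = 2^r and |C|
      |D| = 2^(k + 2r) give |U| = k.\<close>
    have "D = vec.span (C \<union> U)"
      using U iso D by (intro equalityI vec.span_minimal subD) auto
    then have "card D = 2 ^ card U * card C"
      using card_span_orthonormal[OF U(2) C(2)] U(1) CD(2) by auto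
    moreover have "card C = 2 ^ r"
      unfolding C(1) card_span_independent[OF indep] using card_image[OF inj] by simp
    moreover have "card C * card D = 2 ^ (k + 2 * r)"
      using card_mult_card_dual_code[OF C(2)] assms(2) D by simp
    moreover have "(2::nat) ^ r * (2 ^ card U * 2 ^ r) = 2 ^ (card U + 2 * r)"
      by (simp add: mult_2 mult.left_commute flip: power_add)
    ultimately have "(2::nat) ^ (card U + 2 * r) = 2 ^ (k + 2 * r)"
      by metis
    then have "card U = k"
      by simp
    then obtain u where u: "bij_betw u {1..k} U"
      using ex_bij_betw_nat_finite_1[of U] by auto
    have uD: "u j \<in> D" if "j \<in> {1..k}" for j
      using u U(1) that by (auto simp: bij_betw_def)
    have uu: "bdot (u i) (u j) = (if i = j then 1 else 0)" if "i \<in> {1..k}" "j \<in> {1..k}" for i j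
      using u U(2) that by (auto simp: bij_betw_def orthonormal_def inj_on_eq_iff)
    have "symplectic_basis S k (\<lambda>j. pauli_x (u j)) (\<lambda>j. pauli_z (u j))"
      unfolding S
    proof (rule symplectic_basis_orthonormal[OF C(2) iso _ uu])
      show "dual_code C \<subseteq> vec.span (C \<union> u ` {1..k})"
        using U(3) u D by (simp add: bij_betw_def)
    qed (use uD D in auto)
    \<comment> \<open>The identity, labelled by the zero vector, witnesses that the inclusions are
      proper: no \<open>u j\<close> is zero since its self-product is 1.\<close>
    moreover have "0 \<notin> u ` {1..k}"
      using uu by force
    then have "pauli_x 0 \<notin> (\<lambda>j. pauli_x (u j)) ` {1..k}" "pauli_z 0 \<notin> (\<lambda>j. pauli_z (u j)) ` {1..k}"
      by (auto simp: pauli_x_eq pauli_z_eq weyl_inject)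
    then have "(\<lambda>j. pauli_x (u j)) ` {1..k} \<subset> paulis_x" "(\<lambda>j. pauli_z (u j)) ` {1..k} \<subset> paulis_z"
      unfolding paulis_x_eq paulis_z_eq by blast+
    ultimately show s3
      unfolding s3_def
      by - (rule exI[of _ "\<lambda>j. pauli_x (u j)"], rule exI[of _ "\<lambda>j. pauli_z (u j)"],
        simp add: supp_pauli_x supp_pauli_z)
  qed
  have s32: s2 if s3
  proof -
    obtain X Z where XZ: "symplectic_basis S k X Z" "X ` {1..k} \<subset> paulis_x" "Z ` {1..k} \<subset> paulis_z"
      "\<forall>j\<in>{1..k}. supp (X j) = supp (Z j)"
      using \<open>s3\<close> unfolding s3_def by metis
    have 1: "1 \<in> {1..k}"
      using assms(1) by simp
    with XZ(1) have "hyperbolic_pair S (X 1) (Z 1)"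
      by (auto simp: symplectic_basis_def hyperbolic_pair_def)
    moreover have "X 1 \<in> paulis_x" "Z 1 \<in> paulis_z"
      using XZ(2,3) 1 by blast+
    ultimately show s2
      unfolding s2_def using XZ(4) 1 by blast
  qed
  have supp_eq: "v = w" if "supp (pauli_x v) = supp (pauli_z w)" for v w :: "bit ^ 'n"
  proof -
    have "v $ q = 1 \<longleftrightarrow> w $ q = 1" for q
      using that by (auto simp: supp_pauli_x supp_pauli_z)
    then show ?thesis
      by (metis bit_not_one_iff vec_eq_iff)
  qed
  have s21: s1 if s2
  proof -
    obtain v w where hyp: "hyperbolic_pair S (pauli_x v) (pauli_z w)" "supp (pauli_x v) = supp (pauli_z w)"
      using \<open>s2\<close> unfolding s2_def paulis_x_eq paulis_z_eq by blast
    then have "hyperbolic_pair S (pauli_x v) (pauli_z v)"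
      using supp_eq by blast
    then have "v \<in> D" "bdot v v = 1"
      unfolding hyperbolic_pair_def S D pauli_x_eq pauli_z_eq
      by (simp_all add: weyl_in_centralizer C(3) anticommutes_weyl)
    then show s1
      by (rule odd_s1)
  qed
  \<comment> \<open>A basis with equal supports comes from an orthonormal family: anticommutation
    gives the self-products 1, commutation the mixed products 0.\<close>
  have s34: s4 if s3
  proof -
    obtain X Z where XZ: "symplectic_basis S k X Z" "X ` {1..k} \<subset> paulis_x" "Z ` {1..k} \<subset> paulis_z"
      "\<forall>j\<in>{1..k}. supp (X j) = supp (Z j)"
      using \<open>s3\<close> unfolding s3_def by metis
    have "\<exists>v. X j = pauli_x v \<and> Z j = pauli_z v" if j: "j \<in> {1..k}" for j
    proof -
      obtain v w where "X j = pauli_x v" "Z j = pauli_z w"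
        using XZ(2,3) j unfolding paulis_x_eq paulis_z_eq by blast
      then show ?thesis
        using XZ(4) j supp_eq by metis
    qed
    then obtain u where u: "\<And>j. j \<in> {1..k} \<Longrightarrow> X j = pauli_x (u j)" "\<And>j. j \<in> {1..k} \<Longrightarrow> Z j = pauli_z (u j)"
      by metis
    have "u j \<in> dual_code C" if "j \<in> {1..k}" for j
    proof -
      have "X j \<in> centralizer S"
        using XZ(1) that unfolding symplectic_basis_def by blast
      then show ?thesis
        unfolding u(1)[OF that] S pauli_x_eq by (simp add: weyl_in_centralizer C(3))
    qed
    moreover have "bdot (u i) (u j) = (if i = j then 1 else 0)" if ij: "i \<in> {1..k}" "j \<in> {1..k}" for i j
    proof (cases "i = j")
      case True
      have "anticommutes (X j) (Z j)"
        using XZ(1) ij unfolding symplectic_basis_def by blast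
      then show ?thesis
        using True ij by (simp add: u pauli_x_eq pauli_z_eq anticommutes_weyl)
    next
      case False
      then have "commutes (X i) (Z j)"
        using XZ(1) ij unfolding symplectic_basis_def by blast
      then show ?thesis
        using False ij by (simp add: u pauli_x_eq pauli_z_eq commutes_weyl bdot_commute)
    qed
    ultimately have "multilevel_compatible S k X Z"
      unfolding S using u by (intro multilevel_compatible_orthonormal[OF indep C(1) iso])
    then show s4
      unfolding s4_def using XZ(1) by blast
  qed
  have s41: s1 if s4
  proof -
    obtain X Z where XZ: "symplectic_basis S k X Z" "multilevel_compatible S k X Z"
      using \<open>s4\<close> unfolding s4_def by blast
    have 1: "1 \<in> {1..k}"
      using assms(1) by simp
    have "X 1 \<in> centralizer S" "Z 1 \<in> centralizer S" and anti: "anticommutes (X 1) (Z 1)"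
      using XZ(1) 1 unfolding symplectic_basis_def by blast+
    then obtain c a b c' a' b' where X: "X 1 = weyl c a b" and Z: "Z 1 = weyl c' a' b'"
      and c: "c \<in> phases" "c' \<in> phases" and ab: "a \<in> D" "b \<in> D"
      unfolding S D centralizer_css_group[OF C(3)] mem_Collect_eq by metis
    have "eq_mod S (conjugate (tensor (\<lambda>i. hadamard)) (X 1)) (Z 1)"
      using XZ(2) 1 by (simp add: multilevel_compatible_def implements_logical_def logical_hadamard_def)
    then obtain u v where uv: "u \<in> C" "v \<in> C" and
      "conjugate (tensor (\<lambda>i. hadamard)) (X 1) = Z 1 ** weyl 1 u v"
      unfolding eq_mod_def S css_group_def by blast
    then have "b = a' + u" "a = b' + v"
      using c(1) unfolding X Z by (simp_all add: conjugate_hadamard weyl_mult weyl_inject)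
    then have "a' = b + u" "b' = a + v"
      by (simp_all add: add.assoc)
    \<comment> \<open>The stabilizer corrections \<open>u\<close> and \<open>v\<close> lie in the
      radical, so their products with \<open>a\<close> and \<open>b\<close> drop out of the
      anticommutation relation.\<close>
    then have "bdot b b + bdot a a = 1"
      using anti c uv ab unfolding X Z by (simp add: anticommutes_weyl CD)
    then have "bdot a a = 1 \<or> bdot b b = 1"
      by (cases "bdot a a") auto
    then show s1
      using odd_s1 ab by blast
  qed
  show ?thesis
    using s13 s32 s21 s34 s41 by blast
qed

end
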